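(* Let $S$ and $C$ be cancellative right amenable monoids, let $\pi:S\to C$ be a surjective homomorphism admitting a good section $\sigma$, and let $N=\pi^{-1}(1)$. Then, for every $f\in\mathcal S(S)$, $$\mathcal H_S(f)=\mathcal H_C(\Theta_\sigma(f)).$$
   Context: A semigroup $S$ is cancellative if all left and right multiplications are injective. $S$ is right amenable if there is a finitely additive $\mu:\mathcal P(S)\to[0,1]$ with $\mu(S)=1$ and $\mu(R_s^{-1}(F))=\mu(F)$ for all $s\in S$, $F\subseteq S$, where $R_s(x)=xs$. A right Følner net of $S$ is a net $(F_i)_{i\in I}$ of non-empty finite subsets of $S$ with $\lim_{i\in I}|F_is\setminus F_i|/|F_i|=0$ for every $s\in S$. Let $\mathcal P_{fin}(S)$ be the set of non-empty finite subsets of $S$. For a cancellative right amenable semigroup $S$, $\mathcal S(S)$ denotes the set of all functions $f:\mathcal P_{fin}(S)\to\mathbb R_{\ge0}$ that are increasing ($f(F)\le f(F')$ if $F\subseteq F'$), subadditive ($f(F\cup F')\le f(F)+f(F')$), left subinvariant ($f(sF)\le f(F)$ for $s\in S$), and uniformly bounded on singletons (there is $M\geq 0$ with $f(\{s\})\le M$ for all $s\in S$). For $f\in\mathcal S(S)$, $\mathcal H_S(f)=\lim_{i\in I}\frac{f(F_i)}{|F_i|}$, where $(F_i)_{i\in I}$ is any right Følner net of $S$; the limit is known to exist, to be finite, and not to depend on the net. For a right amenable subsemigroup $N\le S$ and $f\in\mathcal S(S)$, $\mathcal H_N(f)$ means $\mathcal H_N(f|_{\mathcal P_{fin}(N)})$.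 A section for $\pi$ is a map $\sigma:C\to S$ with $\pi(\sigma(c))=c$ for all $c\in C$; it is good if $\pi^{-1}(c)=N\sigma(c)=\sigma(c)N$ for every $c\in C$, where $N=\pi^{-1}(1)$. When $S$ is right amenable and $\pi$ has a good section, $N$ is right amenable. For $f\in\mathcal S(S)$ and $F\in\mathcal P_{fin}(S)$, $f^F\in\mathcal S(S)$ is defined by $f^F(X)=f(XF)$, where $XF=\{xy:x\in X,y\in F\}$. The function $\Theta_\sigma(f):\mathcal P_{fin}(C)\to\mathbb R_{\ge0}$ is defined by $\Theta_\sigma(f)(X)=\mathcal H_N(f^{\sigma(X)})$; it is known that $\Theta_\sigma(f)\in\mathcal S(C)$ and that it does not depend on the choice of the good section $\sigma$. *)

theory Defs
  imports "HOL-Algebra.Coset" "HOL-Analysis.Analysis"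
begin

text \<open>
  Semigroups are given by the carrier and multiplication of a HOL-Algebra structure. The
  definitions below use the unit only where it is written explicitly.
\<close>

definition cancellative :: "('a, 'm) monoid_scheme \<Rightarrow> bool" where
  "cancellative G \<longleftrightarrow>
     (\<forall>s\<in>carrier G. inj_on (\<lambda>x. s \<otimes>\<^bsub>G\<^esub> x) (carrier G) \<and>
                     inj_on (\<lambda>x. x \<otimes>\<^bsub>G\<^esub> s) (carrier G))"

definition right_amenable :: "('a, 'm) monoid_scheme \<Rightarrow> bool" where
  "right_amenable G \<longleftrightarrow>
     (\<exists>\<mu> :: 'a set \<Rightarrow> real.
        (\<forall>A. A \<subseteq> carrier G \<longrightarrow> 0 \<le> \<mu> A \<and> \<mu> A \<le> 1) \<and>
        \<mu> (carrier G) = 1 \<and>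
        (\<forall>A B. A \<subseteq> carrier G \<longrightarrow> B \<subseteq> carrier G \<longrightarrow> A \<inter> B = {} \<longrightarrow> \<mu> (A \<union> B) = \<mu> A + \<mu> B) \<and>
        (\<forall>s\<in>carrier G. \<forall>A. A \<subseteq> carrier G \<longrightarrow>
           \<mu> {x \<in> carrier G. x \<otimes>\<^bsub>G\<^esub> s \<in> A} = \<mu> A))"

definition fin_subsets :: "('a, 'm) monoid_scheme \<Rightarrow> 'a set set" where
  "fin_subsets G = {F. F \<subseteq> carrier G \<and> finite F \<and> F \<noteq> {}}"

definition directed :: "'i set \<Rightarrow> ('i \<Rightarrow> 'i \<Rightarrow> bool) \<Rightarrow> bool" where
  "directed I leq \<longleftrightarrow> I \<noteq> {} \<and> (\<forall>i\<in>I. leq i i) \<and>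
     (\<forall>i\<in>I. \<forall>j\<in>I. \<forall>k\<in>I. leq i j \<longrightarrow> leq j k \<longrightarrow> leq i k) \<and>
     (\<forall>i\<in>I. \<forall>j\<in>I. \<exists>k\<in>I. leq i k \<and> leq j k)"

text \<open>The filter of eventuality on a directed set; limits of nets are limits along it.\<close>

definition net_filter :: "'i set \<Rightarrow> ('i \<Rightarrow> 'i \<Rightarrow> bool) \<Rightarrow> 'i filter" where
  "net_filter I leq = (INF i\<in>I. principal {j \<in> I. leq i j})"

definition right_folner_net ::
    "('a, 'm) monoid_scheme \<Rightarrow> 'i set \<Rightarrow> ('i \<Rightarrow> 'i \<Rightarrow> bool) \<Rightarrow> ('i \<Rightarrow> 'a set) \<Rightarrow> bool" where
  "right_folner_net G I leq F \<longleftrightarrow>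
     directed I leq \<and> (\<forall>i\<in>I. F i \<in> fin_subsets G) \<and>
     (\<forall>s\<in>carrier G.
        ((\<lambda>i. real (card ((F i #>\<^bsub>G\<^esub> s) - F i)) / real (card (F i))) \<longlongrightarrow> 0) (net_filter I leq))"

text \<open>
  Only the values of a function on \<^const>\<open>fin_subsets\<close> matter; in particular, restriction to a
  subsemigroup amounts to changing the carrier.
\<close>

definition subadd_functions :: "('a, 'm) monoid_scheme \<Rightarrow> ('a set \<Rightarrow> real) set" where
  "subadd_functions G = {f.
     (\<forall>F\<in>fin_subsets G. 0 \<le> f F) \<and>
     (\<forall>F\<in>fin_subsets G. \<forall>F'\<in>fin_subsets G. F \<subseteq> F' \<longrightarrow> f F \<le> f F') \<and>
     (\<forall>F\<in>fin_subsets G. \<forall>F'\<in>fin_subsets G. f (F \<union> F') \<le> f F + f F') \<and>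
     (\<forall>s\<in>carrier G. \<forall>F\<in>fin_subsets G. f (s <#\<^bsub>G\<^esub> F) \<le> f F) \<and>
     (\<exists>M\<ge>0. \<forall>s\<in>carrier G. f {s} \<le> M)}"

text \<open>
  The common limit over all right Folner nets. A definition has to fix the type of the index
  sets; \<open>folner_mean_any_index\<close> and \<open>folner_mean_eqI\<close> below show that the type
  \<^typ>\<open>'a set \<times> nat\<close> loses nothing.
\<close>

definition folner_mean :: "('a, 'm) monoid_scheme \<Rightarrow> ('a set \<Rightarrow> real) \<Rightarrow> real" where
  "folner_mean G f =
     (THE L. \<forall>(I :: ('a set \<times> nat) set) leq F. right_folner_net G I leq F \<longrightarrow>
        ((\<lambda>i. f (F i) / real (card (F i))) \<longlongrightarrow> L) (net_filter I leq))"

definition good_section ::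
    "('a, 'm) monoid_scheme \<Rightarrow> ('c, 'n) monoid_scheme \<Rightarrow> ('a \<Rightarrow> 'c) \<Rightarrow> ('c \<Rightarrow> 'a) \<Rightarrow> bool" where
  "good_section S C \<pi> \<sigma> \<longleftrightarrow>
     (\<forall>c\<in>carrier C. \<sigma> c \<in> carrier S \<and> \<pi> (\<sigma> c) = c \<and>
        {x \<in> carrier S. \<pi> x = c} = kernel S C \<pi> #>\<^bsub>S\<^esub> \<sigma> c \<and>
        {x \<in> carrier S. \<pi> x = c} = \<sigma> c <#\<^bsub>S\<^esub> kernel S C \<pi>)"

text \<open>The translate $f^F$, and $\Theta_\sigma(f)$, where $N = \pi^{-1}(1)$ is \<^const>\<open>kernel\<close>.\<close>

definition right_translate ::
    "('a, 'm) monoid_scheme \<Rightarrow> ('a set \<Rightarrow> real) \<Rightarrow> 'a set \<Rightarrow> 'a set \<Rightarrow> real" where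
  "right_translate S f F X = f (X <#>\<^bsub>S\<^esub> F)"

definition Theta ::
    "('a, 'm) monoid_scheme \<Rightarrow> ('c, 'n) monoid_scheme \<Rightarrow> ('a \<Rightarrow> 'c) \<Rightarrow> ('c \<Rightarrow> 'a) \<Rightarrow>
      ('a set \<Rightarrow> real) \<Rightarrow> 'c set \<Rightarrow> real" where
  "Theta S C \<pi> \<sigma> f X =
     folner_mean (S\<lparr>carrier := kernel S C \<pi>\<rparr>) (right_translate S f (\<sigma> ` X))"

lemma directedD:
  assumes "directed I leq"
  shows "I \<noteq> {}"
    and "\<And>i. i \<in> I \<Longrightarrow> leq i i"
    and "\<And>i j k. i \<in> I \<Longrightarrow> j \<in> I \<Longrightarrow> k \<in> I \<Longrightarrow> leq i j \<Longrightarrow> leq j k \<Longrightarrow> leq i k"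
    and "\<And>i j. i \<in> I \<Longrightarrow> j \<in> I \<Longrightarrow> \<exists>k\<in>I. leq i k \<and> leq j k"
proof -
  note d = assms[unfolded directed_def]
  show "I \<noteq> {}" by (fact d[THEN conjunct1])
  show "\<And>i. i \<in> I \<Longrightarrow> leq i i"
    by (fact d[THEN conjunct2, THEN conjunct1, rule_format])
  show "\<And>i j k. i \<in> I \<Longrightarrow> j \<in> I \<Longrightarrow> k \<in> I \<Longrightarrow> leq i j \<Longrightarrow> leq j k \<Longrightarrow> leq i k"
    by (fact d[THEN conjunct2, THEN conjunct2, THEN conjunct1, rule_format])
  show "\<And>i j. i \<in> I \<Longrightarrow> j \<in> I \<Longrightarrow> \<exists>k\<in>I. leq i k \<and> leq j k"
    by (fact d[THEN conjunct2, THEN conjunct2, THEN conjunct2, rule_format])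
qed

lemma eventually_net_filter:
  assumes "directed I leq"
  shows "eventually P (net_filter I leq) \<longleftrightarrow> (\<exists>i\<in>I. \<forall>j\<in>I. leq i j \<longrightarrow> P j)"
proof -
  have "I \<noteq> {}" using assms by (simp add: directed_def)
  have *: "\<exists>k\<in>I. principal {x \<in> I. leq k x} \<le> inf (principal {x \<in> I. leq i x}) (principal {x \<in> I. leq j x})"
    if "i \<in> I" "j \<in> I" for i j
  proof -
    obtain k where k: "k \<in> I" "leq i k" "leq j k"
      using directedD(4)[OF assms \<open>i \<in> I\<close> \<open>j \<in> I\<close>] by blast
    moreover have "{x \<in> I. leq k x} \<subseteq> {x \<in> I. leq i x} \<inter> {x \<in> I. leq j x}"
      by (auto intro: directedD(3)[OF assms \<open>i \<in> I\<close> k(1) _ k(2)] directedD(3)[OF assms \<open>j \<in> I\<close> k(1) _ k(3)])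
    ultimately show ?thesis by (intro bexI[of _ k]) simp_all
  qed
  show ?thesis unfolding net_filter_def
    by (subst eventually_INF_base[OF \<open>I \<noteq> {}\<close>]) (use * in \<open>auto simp: eventually_principal\<close>)
qed

lemma net_filter_not_bot:
  assumes "directed I leq"
  shows "net_filter I leq \<noteq> bot"
  using directedD(1,2)[OF assms]
  unfolding trivial_limit_def eventually_net_filter[OF assms] by blast

lemma right_folner_net_reindex:
  fixes E :: "'i \<Rightarrow> 'a set"
  assumes E: "right_folner_net G J leq E"
    and freq: "frequently (\<lambda>j. P (E j)) (net_filter J leq)"
  obtains I :: "('a set \<times> nat) set" and leq' F
  where "right_folner_net G I leq' F" "\<And>i. i \<in> I \<Longrightarrow> P (F i)"
proof -
  define I :: "('a set \<times> nat) set" where "I = {(K, n). finite K \<and> K \<subseteq> carrier G}"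
  define leq' :: "'a set \<times> nat \<Rightarrow> 'a set \<times> nat \<Rightarrow> bool"
    where "leq' i j \<longleftrightarrow> fst i \<subseteq> fst j \<and> snd i \<le> snd j" for i j
  define r where "r A s = real (card ((A #>\<^bsub>G\<^esub> s) - A)) / real (card A)" for A s
  have dirJ: "directed J leq" using E by (simp add: right_folner_net_def)
  have "\<exists>A. A \<in> fin_subsets G \<and> P A \<and> (\<forall>s\<in>fst i. r A s < 1 / Suc (snd i))" if i: "i \<in> I" for i
  proof -
    have K: "finite (fst i)" "fst i \<subseteq> carrier G" using i by (auto simp: I_def)
    have "eventually (\<lambda>j. r (E j) s < 1 / Suc (snd i)) (net_filter J leq)" if "s \<in> fst i" for s
    proof -
      have "((\<lambda>j. r (E j) s) \<longlongrightarrow> 0) (net_filter J leq)"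
        using E K(2) that unfolding right_folner_net_def r_def by (simp add: subset_iff)
      then show ?thesis by (rule order_tendstoD) simp
    qed
    then have "eventually (\<lambda>j. \<forall>s\<in>fst i. r (E j) s < 1 / Suc (snd i)) (net_filter J leq)"
      using K by (simp add: eventually_ball_finite)
    moreover have "eventually (\<lambda>j. j \<in> J) (net_filter J leq)"
      using directedD(1)[OF dirJ] by (auto simp: eventually_net_filter[OF dirJ])
    ultimately have "eventually (\<lambda>j. j \<in> J \<and> (\<forall>s\<in>fst i. r (E j) s < 1 / Suc (snd i)))
        (net_filter J leq)"
      by (simp add: eventually_conj)
    from frequently_ex[OF frequently_eventually_conj[OF freq this]]
    obtain j where "P (E j)" "j \<in> J" "\<forall>s\<in>fst i. r (E j) s < 1 / Suc (snd i)"
      by blast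
    then show ?thesis using E by (auto simp: right_folner_net_def)
  qed
  then have "\<forall>i\<in>I. \<exists>A. A \<in> fin_subsets G \<and> P A \<and> (\<forall>s\<in>fst i. r A s < 1 / Suc (snd i))"
    by blast
  from bchoice[OF this] obtain F where F: "\<And>i. i \<in> I \<Longrightarrow> F i \<in> fin_subsets G"
      "\<And>i. i \<in> I \<Longrightarrow> P (F i)" "\<And>i s. i \<in> I \<Longrightarrow> s \<in> fst i \<Longrightarrow> r (F i) s < 1 / Suc (snd i)"
    by blast
  have dirI: "directed I leq'" unfolding directed_def
  proof (intro conjI ballI impI)
    show "I \<noteq> {}" by (auto simp: I_def)
    fix i j assume "i \<in> I" "j \<in> I"
    then show "\<exists>k\<in>I. leq' i k \<and> leq' j k"
      by (intro bexI[of _ "(fst i \<union> fst j, max (snd i) (snd j))"]) (auto simp: I_def leq'_def)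
  qed (auto simp: leq'_def)
  have "((\<lambda>i. r (F i) s) \<longlongrightarrow> 0) (net_filter I leq')" if s: "s \<in> carrier G" for s
  proof (rule tendstoI)
    fix e :: real assume "e > 0"
    then obtain n where n: "1 / Suc n < e" using nat_approx_posE by blast
    have "dist (r (F j) s) 0 < e" if "j \<in> I" "leq' ({s}, n) j" for j
    proof -
      have "r (F j) s < 1 / Suc (snd j)" using F that by (auto simp: leq'_def)
      also have "\<dots> \<le> 1 / Suc n" using that by (auto simp: leq'_def intro!: divide_left_mono)
      finally show ?thesis using n by (simp add: r_def)
    qed
    moreover have "({s}, n) \<in> I" using s by (simp add: I_def)
    ultimately show "eventually (\<lambda>j. dist (r (F j) s) 0 < e) (net_filter I leq')"
      unfolding eventually_net_filter[OF dirI] by blast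
  qed
  then have "right_folner_net G I leq' F"
    using dirI F by (simp add: right_folner_net_def r_def)
  then show thesis using F that by blast
qed

lemma folner_mean_any_index:
  fixes E :: "'i \<Rightarrow> 'a set"
  assumes L: "\<And>(I :: ('a set \<times> nat) set) leq F. right_folner_net G I leq F \<Longrightarrow>
        ((\<lambda>i. f (F i) / real (card (F i))) \<longlongrightarrow> L) (net_filter I leq)"
    and E: "right_folner_net G J leq' E"
  shows "((\<lambda>j. f (E j) / real (card (E j))) \<longlongrightarrow> (L :: real)) (net_filter J leq')"
proof (rule ccontr)
  assume "\<not> ?thesis"
  then obtain e where e: "e > 0"
    "frequently (\<lambda>j. e \<le> dist (f (E j) / real (card (E j))) L) (net_filter J leq')"
    unfolding tendsto_iff by (auto simp: frequently_def not_le)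
  obtain I :: "('a set \<times> nat) set" and leq F where F: "right_folner_net G I leq F"
      "\<And>i. i \<in> I \<Longrightarrow> e \<le> dist (f (F i) / real (card (F i))) L"
    using right_folner_net_reindex[OF E, of "\<lambda>A. e \<le> dist (f A / real (card A)) L"] e(2) by blast
  have dirI: "directed I leq" using F by (simp add: right_folner_net_def)
  have "eventually (\<lambda>i. dist (f (F i) / real (card (F i))) L < e) (net_filter I leq)"
    using L[OF F(1)] e(1) by (rule tendstoD)
  then show False
    using F(2) directedD(2)[OF dirI] unfolding eventually_net_filter[OF dirI] by (metis not_less)
qed

lemma folner_mean_eqI:
  fixes E :: "'i \<Rightarrow> 'a set"
  assumes L: "\<And>(I :: ('a set \<times> nat) set) leq F. right_folner_net G I leq F \<Longrightarrow>
        ((\<lambda>i. f (F i) / real (card (F i))) \<longlongrightarrow> L) (net_filter I leq)"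
    and E: "right_folner_net G J leq' E"
  shows "folner_mean G f = L"
proof -
  have "net_filter J leq' \<noteq> bot"
    using E by (simp add: right_folner_net_def net_filter_not_bot)
  then have "frequently (\<lambda>j. True) (net_filter J leq')"
    by (simp add: frequently_def trivial_limit_def)
  then obtain I :: "('a set \<times> nat) set" and leq F where F: "right_folner_net G I leq F"
    by (rule right_folner_net_reindex[OF E, of "\<lambda>_. True"])
  have "net_filter I leq \<noteq> bot"
    using F by (simp add: right_folner_net_def net_filter_not_bot)
  show ?thesis unfolding folner_mean_def
  proof (rule the_equality)
    fix L'
    assume "\<forall>(I :: ('a set \<times> nat) set) leq F. right_folner_net G I leq F \<longrightarrow>
        ((\<lambda>i. f (F i) / real (card (F i))) \<longlongrightarrow> L') (net_filter I leq)"
    then have "((\<lambda>i. f (F i) / real (card (F i))) \<longlongrightarrow> L') (net_filter I leq)"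
      using F by (elim allE impE)
    then show "L' = L"
      using L[OF F] by (rule tendsto_unique[OF \<open>net_filter I leq \<noteq> bot\<close>])
  qed (intro allI impI L)
qed

end

theory Submission
  imports Defs
begin

text \<open>
  If \<open>X\<close> is a Folner set of \<open>C\<close> and \<open>A\<close> is a Folner set of \<open>N\<close> that is sufficiently invariant
  depending on \<open>X\<close>, then \<open>A \<sigma>(X)\<close> is a Folner set of \<open>S\<close> with \<open>|A| |X|\<close> elements. Dividing
  \<open>f(A \<sigma>(X))\<close> by \<open>|A|\<close> gives approximately \<open>\<Theta>(X)\<close>, and dividing by \<open>|A| |X|\<close> gives approximately
  \<open>H(f)\<close>; hence \<open>\<Theta>(X) / |X|\<close> is close to \<open>H(f)\<close>. This needs limits along \<open>S\<close> and \<open>N\<close> only, so it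
  is not necessary to know beforehand that \<open>\<Theta>\<close> is subadditive.

  Amenability yields Folner sets by a counting argument: without them some finite \<open>K\<close> satisfies
  \<open>|FK| \<ge> 2 |F|\<close> for all finite \<open>F\<close>, and Hall's theorem turns this into a paradoxical decomposition.
  The limits exist by quasi-tiling: a Folner set is covered, up to a small remainder, by almost
  disjoint left translates of Folner sets of decreasing scales, each chosen greedily.
\<close>

subsection \<open>Hall's theorem\<close>

text \<open>Rado's argument: in a family of finite sets that is minimal for Hall's condition every member
  is a singleton. Minimality is expressed by the maximal relation \<open>D\<close> of removed pairs.\<close>

lemma hall_transversal:
  fixes A :: "'i \<Rightarrow> 'b set"
  assumes fin: "\<And>i. i \<in> I \<Longrightarrow> finite (A i)"
    and hall: "\<And>J. finite J \<Longrightarrow> J \<subseteq> I \<Longrightarrow> card J \<le> card (\<Union>i\<in>J. A i)"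
  obtains m where "inj_on m I" "\<And>i. i \<in> I \<Longrightarrow> m i \<in> A i"
proof -
  define rest where "rest D J = snd ` (Sigma J A - D)" for D J
  \<comment> \<open>\<open>D\<close> is a set of deleted pairs \<open>(i, b)\<close>, and
    \<open>H D\<close> is Hall's condition for what is left. Zorn's lemma replaces deletion one by
    one, since \<open>I\<close> may be infinite.\<close>
  define H where "H D \<longleftrightarrow> (\<forall>J. finite J \<longrightarrow> J \<subseteq> I \<longrightarrow> card J \<le> card (rest D J))" for D
  have rest_empty: "rest {} J = (\<Union>i\<in>J. A i)" for J
    by (simp add: rest_def image_UN Sigma_def)
  have "\<exists>D\<in>Collect H. \<forall>X\<in>Collect H. D \<subseteq> X \<longrightarrow> X = D"
  proof (rule subset_Zorn_nonempty)
    have "H {}" unfolding H_def rest_empty using hall by blast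
    then show "Collect H \<noteq> {}" by blast
  next
    fix c assume c: "c \<noteq> {}" "subset.chain (Collect H) c"
    have "card J \<le> card (rest (\<Union>c) J)" if J: "finite J" "J \<subseteq> I" for J
    proof -
      \<comment> \<open>A finite \<open>J\<close> sees only finitely many pairs, so those deleted by
        the union of the chain are already deleted by one of its members.\<close>
      have "finite (Sigma J A)" using J fin by (intro finite_SigmaI) auto
      then have "finite (Sigma J A \<inter> \<Union>c)" by blast
      then obtain D where D: "D \<in> c" "Sigma J A \<inter> \<Union>c \<subseteq> D"
        using finite_subset_Union_chain[OF _ _ c] by blast
      then have "Sigma J A - \<Union>c = Sigma J A - D" by blast
      moreover have "H D" using c D unfolding subset.chain_def by blast
      ultimately show ?thesis using J unfolding H_def rest_def by simp
    qed
    then show "\<Union>c \<in> Collect H" unfolding H_def by blast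
  qed
  then obtain D where HD: "H D" and max: "\<And>X. H X \<Longrightarrow> D \<subseteq> X \<Longrightarrow> X = D" by blast
  define B where "B i = {b \<in> A i. (i, b) \<notin> D}" for i
  have restB: "rest D J = (\<Union>i\<in>J. B i)" for J
    by (auto simp: rest_def B_def image_iff Bex_def)
  have finB: "finite (B i)" if "i \<in> I" for i using fin[OF that] by (simp add: B_def)
  have hallB: "card J \<le> card (\<Union>i\<in>J. B i)" if "finite J" "J \<subseteq> I" for J
    using HD that unfolding H_def restB by blast
  \<comment> \<open>By maximality of \<open>D\<close>, deleting \<open>(i, x)\<close> as well breaks
    Hall's condition at some set. That set must contain \<open>i\<close>; taking \<open>i\<close>
    out of it gives \<open>J\<close> and turns the strict bound into
    \<open>\<le> card J\<close>.\<close>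
  have blocked: "\<exists>J. finite J \<and> J \<subseteq> I \<and> i \<notin> J \<and> card ((\<Union>j\<in>J. B j) \<union> (B i - {x})) \<le> card J"
    if i: "i \<in> I" and x: "x \<in> B i" for i x
  proof -
    have "\<not> H (insert (i, x) D)"
      using max[of "insert (i, x) D"] x by (auto simp: B_def)
    then obtain J where J: "finite J" "J \<subseteq> I" "card (rest (insert (i, x) D) J) < card J"
      unfolding H_def by (auto simp: not_le)
    have "i \<in> J"
    proof (rule ccontr)
      assume "i \<notin> J"
      then have "Sigma J A - insert (i, x) D = Sigma J A - D" by blast
      then have "rest (insert (i, x) D) J = rest D J" by (simp add: rest_def)
      then show False using J hallB[OF J(1,2)] by (simp add: restB)
    qed
    have "rest (insert (i, x) D) J = (\<Union>j\<in>J - {i}. B j) \<union> (B i - {x})"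
    proof (intro equalityI subsetI)
      fix b assume "b \<in> rest (insert (i, x) D) J"
      then show "b \<in> (\<Union>j\<in>J - {i}. B j) \<union> (B i - {x})" by (auto simp: rest_def B_def)
    next
      fix b assume "b \<in> (\<Union>j\<in>J - {i}. B j) \<union> (B i - {x})"
      then obtain j where "(j, b) \<in> Sigma J A - insert (i, x) D"
        using \<open>i \<in> J\<close> by (auto simp: B_def)
      then show "b \<in> rest (insert (i, x) D) J" unfolding rest_def by force
    qed
    then show ?thesis using J \<open>i \<in> J\<close>
      by (intro exI[of _ "J - {i}"]) auto
  qed
  have single: "x = y" if i: "i \<in> I" and x: "x \<in> B i" and y: "y \<in> B i" for i x y
  proof (rule ccontr)
    assume "x \<noteq> y"
    from blocked[OF i x] obtain J where J: "finite J" "J \<subseteq> I" "i \<notin> J"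
      "card ((\<Union>j\<in>J. B j) \<union> (B i - {x})) \<le> card J" by blast
    from blocked[OF i y] obtain K where K: "finite K" "K \<subseteq> I" "i \<notin> K"
      "card ((\<Union>j\<in>K. B j) \<union> (B i - {y})) \<le> card K" by blast
    let ?X = "(\<Union>j\<in>J. B j) \<union> (B i - {x})" and ?Y = "(\<Union>j\<in>K. B j) \<union> (B i - {y})"
    have fX: "finite ?X" and fY: "finite ?Y" using J K i finB by auto
    \<comment> \<open>Since \<open>x\<close> and \<open>y\<close> differ, the union regains all of
      \<open>B i\<close>. Hence \<open>|?X| + |?Y| = |?X \<union> ?Y| + |?X \<inter> ?Y|\<close> is
      at least \<open>|J \<union> K| + 1 + |J \<inter> K| = |J| + |K| + 1\<close>, against the two
      upper bounds.\<close>
    have un: "?X \<union> ?Y = (\<Union>j\<in>insert i (J \<union> K). B j)" using \<open>x \<noteq> y\<close> by blast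
    have "card (insert i (J \<union> K)) \<le> card (?X \<union> ?Y)"
      unfolding un using J K i by (intro hallB) auto
    moreover have "card (insert i (J \<union> K)) = Suc (card (J \<union> K))" using J K by simp
    moreover have "card (J \<inter> K) \<le> card (\<Union>j\<in>J \<inter> K. B j)" using J K by (intro hallB) auto
    moreover have "card (\<Union>j\<in>J \<inter> K. B j) \<le> card (?X \<inter> ?Y)"
      using fX by (intro card_mono) auto
    ultimately show False
      using card_Un_Int[OF fX fY] card_Un_Int[OF J(1) K(1)] J(4) K(4) by linarith
  qed
  have "\<exists>x. x \<in> B i" if "i \<in> I" for i
    using hallB[of "{i}"] that by (auto simp: card_gt_0_iff Suc_le_eq)
  then obtain m where m: "\<And>i. i \<in> I \<Longrightarrow> m i \<in> B i" by metis
  have "inj_on m I"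
  proof (rule inj_onI, rule ccontr)
    fix i j assume ij: "i \<in> I" "j \<in> I" "m i = m j" "i \<noteq> j"
    then have "(\<Union>k\<in>{i, j}. B k) \<subseteq> {m i}" using m single by auto
    then have "card (\<Union>k\<in>{i, j}. B k) \<le> card {m i}" by (intro card_mono) auto
    then show False using hallB[of "{i, j}"] ij by simp
  qed
  then show thesis using that m by (auto simp: B_def)
qed

subsection \<open>Folner sets\<close>

text \<open>Counts the points that \<open>s\<close> moves out of \<open>F\<close> rather than the
  set \<open>F s - F\<close>; \<open>card_r_coset_diff\<close> identifies the two numbers by right
  cancellation.\<close>

definition almost_invariant ::
    "('a, 'm) monoid_scheme \<Rightarrow> 'a set \<Rightarrow> real \<Rightarrow> 'a set \<Rightarrow> bool" where
  "almost_invariant G E d F \<longleftrightarrow> F \<in> fin_subsets G \<and>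
     (\<forall>s\<in>E. real (card {x \<in> F. x \<otimes>\<^bsub>G\<^esub> s \<notin> F}) \<le> d * real (card F))"

text \<open>Convergence of the means without nets, so that tolerances can be handled directly. It
  determines \<open>L\<close> only if almost invariant sets exist for all \<open>E\<close> and
  \<open>d\<close>.\<close>

definition folner_limit :: "('a, 'm) monoid_scheme \<Rightarrow> ('a set \<Rightarrow> real) \<Rightarrow> real \<Rightarrow> bool" where
  "folner_limit G f L \<longleftrightarrow> (\<forall>e>0. \<exists>E d. finite E \<and> E \<subseteq> carrier G \<and> d > 0 \<and>
     (\<forall>F. almost_invariant G E d F \<longrightarrow> \<bar>f F / real (card F) - L\<bar> < e))"

lemma almost_invariant_mono:
  assumes "almost_invariant G E d F" "E' \<subseteq> E" "d \<le> d'"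
  shows "almost_invariant G E' d' F"
proof -
  have "d * real (card F) \<le> d' * real (card F)" using assms by (intro mult_right_mono) auto
  then show ?thesis using assms unfolding almost_invariant_def by (blast intro: order_trans)
qed

lemma almost_invariant_card_pos:
  "almost_invariant G E d F \<Longrightarrow> card F > 0"
  by (auto simp: almost_invariant_def fin_subsets_def card_gt_0_iff)

locale cancellative_monoid = monoid +
  assumes cancel: "cancellative G"
begin

lemma inj_left: "s \<in> carrier G \<Longrightarrow> A \<subseteq> carrier G \<Longrightarrow> inj_on (\<lambda>x. s \<otimes> x) A"
  and inj_right: "s \<in> carrier G \<Longrightarrow> A \<subseteq> carrier G \<Longrightarrow> inj_on (\<lambda>x. x \<otimes> s) A"
  using cancel unfolding cancellative_def by (meson inj_on_subset)+

lemma r_cancel': "x \<otimes> s = y \<otimes> s \<Longrightarrow> s \<in> carrier G \<Longrightarrow> x \<in> carrier G \<Longrightarrow> y \<in> carrier G \<Longrightarrow> x = y"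
  using inj_right[of s "carrier G"] by (auto dest: inj_onD)

lemma l_cancel': "s \<otimes> x = s \<otimes> y \<Longrightarrow> s \<in> carrier G \<Longrightarrow> x \<in> carrier G \<Longrightarrow> y \<in> carrier G \<Longrightarrow> x = y"
  using inj_left[of s "carrier G"] by (auto dest: inj_onD)

lemma card_r_coset_diff:
  assumes "F \<subseteq> carrier G" "s \<in> carrier G"
  shows "card ((F #> s) - F) = card {x \<in> F. x \<otimes> s \<notin> F}"
proof -
  have "(F #> s) - F = (\<lambda>x. x \<otimes> s) ` {x \<in> F. x \<otimes> s \<notin> F}"
    by (auto simp: r_coset_def)
  moreover have "inj_on (\<lambda>x. x \<otimes> s) {x \<in> F. x \<otimes> s \<notin> F}"
    using assms by (intro inj_right) auto
  ultimately show ?thesis by (simp add: card_image)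
qed

lemma eventually_almost_invariant:
  assumes F: "right_folner_net G I leq F" and E: "finite E" "E \<subseteq> carrier G" and d: "d > 0"
  shows "eventually (\<lambda>i. almost_invariant G E d (F i)) (net_filter I leq)"
proof -
  have dirI: "directed I leq" using F by (simp add: right_folner_net_def)
  have I: "eventually (\<lambda>i. i \<in> I) (net_filter I leq)"
    using directedD(1)[OF dirI] by (auto simp: eventually_net_filter[OF dirI])
  have "eventually (\<lambda>i. real (card ((F i #> s) - F i)) / real (card (F i)) < d) (net_filter I leq)"
    if "s \<in> E" for s
    using F E d that unfolding right_folner_net_def by (intro order_tendstoD) auto
  then have "eventually (\<lambda>i. \<forall>s\<in>E. real (card ((F i #> s) - F i)) / real (card (F i)) < d)
      (net_filter I leq)"
    using E by (simp add: eventually_ball_finite)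
  then show ?thesis using I
  proof eventually_elim
    case (elim i)
    then have Fi: "F i \<in> fin_subsets G" using F by (simp add: right_folner_net_def)
    then have "card (F i) > 0" by (auto simp: fin_subsets_def card_gt_0_iff)
    have "card {x \<in> F i. x \<otimes> s \<notin> F i} \<le> d * card (F i)" if "s \<in> E" for s
    proof -
      have "card ((F i #> s) - F i) = card {x \<in> F i. x \<otimes> s \<notin> F i}"
        using that Fi E by (intro card_r_coset_diff) (auto simp: fin_subsets_def)
      moreover have "real (card ((F i #> s) - F i)) / real (card (F i)) < d"
        using elim that by blast
      ultimately show ?thesis using \<open>card (F i) > 0\<close> by (simp add: pos_divide_less_eq)
    qed
    then show ?case using Fi by (simp add: almost_invariant_def)
  qed
qed

text \<open>An index \<open>(K, n)\<close> is a demand, namely invariance under \<open>K\<close> up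
  to \<open>1 / Suc n\<close>, and larger indices demand more. Any choice of sets meeting the
  demands is a Folner net.\<close>

lemma right_folner_net_exists:
  assumes ex: "\<And>E d. finite E \<Longrightarrow> E \<subseteq> carrier G \<Longrightarrow> d > 0 \<Longrightarrow> \<exists>F. almost_invariant G E d F"
  obtains I :: "('a set \<times> nat) set" and leq F where "right_folner_net G I leq F"
proof -
  define I :: "('a set \<times> nat) set" where "I = {(K, n). finite K \<and> K \<subseteq> carrier G}"
  define leq :: "'a set \<times> nat \<Rightarrow> 'a set \<times> nat \<Rightarrow> bool"
    where "leq i j \<longleftrightarrow> fst i \<subseteq> fst j \<and> snd i \<le> snd j" for i j
  have "\<forall>i\<in>I. \<exists>F. almost_invariant G (fst i) (1 / Suc (snd i)) F"
  proof
    fix i assume "i \<in> I"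
    then show "\<exists>F. almost_invariant G (fst i) (1 / Suc (snd i)) F"
      by (intro ex) (auto simp: I_def)
  qed
  from bchoice[OF this]
  obtain F where F: "\<And>i. i \<in> I \<Longrightarrow> almost_invariant G (fst i) (1 / Suc (snd i)) (F i)"
    by blast
  have dirI: "directed I leq" unfolding directed_def
  proof (intro conjI ballI impI)
    show "I \<noteq> {}" by (auto simp: I_def)
    fix i j assume "i \<in> I" "j \<in> I"
    then show "\<exists>k\<in>I. leq i k \<and> leq j k"
      by (intro bexI[of _ "(fst i \<union> fst j, max (snd i) (snd j))"]) (auto simp: I_def leq_def)
  qed (auto simp: leq_def)
  have "((\<lambda>i. real (card ((F i #> s) - F i)) / real (card (F i))) \<longlongrightarrow> 0) (net_filter I leq)"
    if s: "s \<in> carrier G" for s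
  proof (rule tendstoI)
    fix e :: real assume "e > 0"
    then obtain n where n: "1 / Suc n < e" using nat_approx_posE by blast
    have "dist (real (card ((F j #> s) - F j)) / real (card (F j))) 0 < e"
      if j: "j \<in> I" "leq ({s}, n) j" for j
    proof -
      have "1 / Suc (snd j) \<le> 1 / Suc n" using j by (auto simp: leq_def intro!: divide_left_mono)
      moreover have "{s} \<subseteq> fst j" using j by (simp add: leq_def)
      ultimately have inv: "almost_invariant G {s} (1 / Suc n) (F j)"
        by (rule almost_invariant_mono[OF F[OF j(1)], rotated])
      then have "real (card ((F j #> s) - F j)) \<le> 1 / Suc n * real (card (F j))"
        using card_r_coset_diff[of "F j" s] s by (simp add: almost_invariant_def fin_subsets_def)
      then have "real (card ((F j #> s) - F j)) / real (card (F j)) \<le> 1 / Suc n"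
        using almost_invariant_card_pos[OF inv] by (simp add: divide_simps)
      then show ?thesis using n by simp
    qed
    moreover have "({s}, n) \<in> I" using s by (simp add: I_def)
    ultimately show "eventually (\<lambda>j. dist (real (card ((F j #> s) - F j)) / real (card (F j))) 0 < e)
        (net_filter I leq)"
      unfolding eventually_net_filter[OF dirI] by blast
  qed
  moreover have "F i \<in> fin_subsets G" if "i \<in> I" for i
    using F[OF that] by (simp add: almost_invariant_def)
  ultimately have "right_folner_net G I leq F"
    using dirI by (simp add: right_folner_net_def)
  then show thesis by (rule that)
qed

text \<open>The bridge from \<open>folner_mean\<close> to \<open>folner_limit\<close>. The means
  tend to \<open>L\<close> along every net, and \<open>ex\<close> provides at least one net, which
  makes the value of the definite description unique.\<close>

lemma folner_mean_eq_limit: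
  assumes ex: "\<And>E d. finite E \<Longrightarrow> E \<subseteq> carrier G \<Longrightarrow> d > 0 \<Longrightarrow> \<exists>F. almost_invariant G E d F"
    and L: "folner_limit G f L"
  shows "folner_mean G f = L"
proof -
  obtain J :: "('a set \<times> nat) set" and leq' E where E: "right_folner_net G J leq' E"
    using right_folner_net_exists[OF ex] by blast
  show ?thesis
  proof (rule folner_mean_eqI[OF _ E])
    fix I :: "('a set \<times> nat) set" and leq F assume F: "right_folner_net G I leq F"
    show "((\<lambda>i. f (F i) / real (card (F i))) \<longlongrightarrow> L) (net_filter I leq)"
    proof (rule tendstoI)
      fix e :: real assume "e > 0"
      from L[unfolded folner_limit_def, rule_format, OF this]
      obtain E d where E: "finite E" "E \<subseteq> carrier G" "d > 0"
        and lim: "\<And>F. almost_invariant G E d F \<Longrightarrow> \<bar>f F / real (card F) - L\<bar> < e"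
        by blast
      show "eventually (\<lambda>i. dist (f (F i) / real (card (F i))) L < e) (net_filter I leq)"
        using eventually_almost_invariant[OF F E]
        by (rule eventually_mono) (simp add: dist_real_def lim)
    qed
  qed
qed

section \<open>From amenability to Folner sets\<close>

lemma set_mult_assoc_monoid:
  assumes "M \<subseteq> carrier G" "H \<subseteq> carrier G" "K \<subseteq> carrier G"
  shows "(M <#> H) <#> K = M <#> (H <#> K)"
proof (intro equalityI subsetI)
  fix x assume "x \<in> (M <#> H) <#> K"
  then obtain m h k where "m \<in> M" "h \<in> H" "k \<in> K" "x = m \<otimes> h \<otimes> k"
    unfolding set_mult_def by blast
  moreover from this have "x = m \<otimes> (h \<otimes> k)" using assms by (simp add: m_assoc subset_iff)
  ultimately show "x \<in> M <#> (H <#> K)" unfolding set_mult_def by blast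
next
  fix x assume "x \<in> M <#> (H <#> K)"
  then obtain m h k where "m \<in> M" "h \<in> H" "k \<in> K" "x = m \<otimes> (h \<otimes> k)"
    unfolding set_mult_def by blast
  moreover from this have "x = m \<otimes> h \<otimes> k" using assms by (simp add: m_assoc subset_iff)
  ultimately show "x \<in> (M <#> H) <#> K" unfolding set_mult_def by blast
qed

text \<open>The element \<open>s\<close> in \<open>exp\<close> depends on \<open>F\<close>, but
  \<open>F\<close> and \<open>F s\<close> both lie in the product of \<open>F\<close> with
  \<open>E \<union> {1}\<close>. This one finite set enlarges every \<open>F\<close> by the factor
  \<open>1 + d\<close>, and its powers give \<open>K\<close>.\<close>

lemma expansion_power:
  assumes E: "finite E" "E \<subseteq> carrier G"
    and exp: "\<And>F. F \<in> fin_subsets G \<Longrightarrow> \<exists>s\<in>E. real (card {x \<in> F. x \<otimes> s \<notin> F}) > d * real (card F)"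
  shows "d \<ge> 0 \<Longrightarrow> \<exists>K. finite K \<and> K \<subseteq> carrier G \<and> K \<noteq> {} \<and>
    (\<forall>F\<in>fin_subsets G. (1 + d) ^ n * real (card F) \<le> real (card (F <#> K)))"
proof (induction n)
  case 0
  have "F <#> {\<one>} = F" if "F \<in> fin_subsets G" for F
    using that by (force simp: set_mult_def fin_subsets_def)
  then show ?case by (intro exI[of _ "{\<one>}"]) auto
next
  case (Suc n)
  then obtain K where K: "finite K" "K \<subseteq> carrier G" "K \<noteq> {}"
    "\<And>F. F \<in> fin_subsets G \<Longrightarrow> (1 + d) ^ n * real (card F) \<le> real (card (F <#> K))" by blast
  let ?E = "insert \<one> E"
  have E': "?E \<subseteq> carrier G" using E by auto
  have step: "(1 + d) * real (card F) \<le> real (card (F <#> ?E))" if F: "F \<in> fin_subsets G" for F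
  proof -
    have F': "finite F" "F \<subseteq> carrier G" using F by (auto simp: fin_subsets_def)
    obtain s where s: "s \<in> E" "real (card {x \<in> F. x \<otimes> s \<notin> F}) > d * real (card F)"
      using exp[OF F] by blast
    have sc: "s \<in> carrier G" using s E by auto
    have "F \<union> ((F #> s) - F) \<subseteq> F <#> ?E"
      using F' s by (force simp: set_mult_def r_coset_def)
    moreover have "finite (F <#> ?E)" using F' E by (simp add: set_mult_def)
    ultimately have "card (F \<union> ((F #> s) - F)) \<le> card (F <#> ?E)" by (intro card_mono)
    moreover have "card (F \<union> ((F #> s) - F)) = card F + card {x \<in> F. x \<otimes> s \<notin> F}"
      using F' sc by (subst card_Un_disjoint)
        (auto simp: card_r_coset_diff[symmetric], simp add: r_coset_def)
    ultimately show ?thesis using s by (simp add: algebra_simps)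
  qed
  have "(1 + d) ^ Suc n * real (card F) \<le> real (card (F <#> (K <#> ?E)))"
    if F: "F \<in> fin_subsets G" for F
  proof -
    have FK: "F <#> K \<in> fin_subsets G"
      using F K by (auto simp: fin_subsets_def set_mult_def)
    have "(1 + d) ^ Suc n * real (card F) \<le> (1 + d) * real (card (F <#> K))"
      using K(4)[OF F] Suc.prems by (simp add: mult.assoc mult_left_mono)
    also have "\<dots> \<le> real (card ((F <#> K) <#> ?E))" by (rule step[OF FK])
    also have "(F <#> K) <#> ?E = F <#> (K <#> ?E)"
      using F K E' by (intro set_mult_assoc_monoid) (auto simp: fin_subsets_def)
    finally show ?thesis .
  qed
  moreover have "K <#> ?E \<subseteq> carrier G" "finite (K <#> ?E)" "K <#> ?E \<noteq> {}"
    using K E E' by (auto simp: set_mult_def)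
  ultimately show ?case by blast
qed

text \<open>If no such \<open>F\<close> existed, Hall's theorem would place two disjoint copies of
  \<open>G\<close> inside \<open>G\<close>, every point being moved by right multiplication with an
  element of a finite \<open>K\<close>. An invariant mean would then give \<open>G\<close> mass at
  least 2.\<close>

lemma almost_invariant_exists:
  assumes am: "right_amenable G" and E: "finite E" "E \<subseteq> carrier G" and d: "d > 0"
  shows "\<exists>F. almost_invariant G E d F"
proof (rule ccontr)
  assume no: "\<nexists>F. almost_invariant G E d F"
  have exp: "\<exists>s\<in>E. real (card {x \<in> F. x \<otimes> s \<notin> F}) > d * real (card F)"
    if F: "F \<in> fin_subsets G" for F
  proof (rule ccontr)
    assume "\<not> ?thesis"
    then have "almost_invariant G E d F" using F by (simp add: almost_invariant_def not_less)
    then show False using no by blast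
  qed
  obtain n where "2 < (1 + d) ^ n" using real_arch_pow[of "1 + d" 2] d by auto
  from expansion_power[OF E exp, of n] d
  obtain K where K: "finite K" "K \<subseteq> carrier G" "K \<noteq> {}"
    "\<And>F. F \<in> fin_subsets G \<Longrightarrow> (1 + d) ^ n * real (card F) \<le> real (card (F <#> K))"
    by auto
  have K2: "2 * card F \<le> card (F <#> K)" if F: "F \<in> fin_subsets G" for F
  proof -
    have "2 * real (card F) \<le> (1 + d) ^ n * real (card F)"
      using \<open>2 < (1 + d) ^ n\<close> by (intro mult_right_mono) auto
    also note K(4)[OF F]
    finally show ?thesis by linarith
  qed
  \<comment> \<open>The \<open>bool\<close> component distinguishes the two copies;
    \<open>A p\<close> lists the places to which \<open>p\<close> may be sent.\<close>
  let ?I = "carrier G \<times> (UNIV :: bool set)"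
  define A where "A p = (\<lambda>k. fst p \<otimes> k) ` K" for p :: "'a \<times> bool"
  have hall: "card J \<le> card (\<Union>p\<in>J. A p)" if J: "finite J" "J \<subseteq> ?I" for J
  proof (cases "J = {}")
    case False
    have F: "fst ` J \<in> fin_subsets G" using J False by (auto simp: fin_subsets_def)
    \<comment> \<open>\<open>J\<close> has at most two elements over each point of its projection,
      which the factor 2 in \<open>K2\<close> matches.\<close>
    have "card J \<le> card (fst ` J \<times> (UNIV :: bool set))"
      using J by (intro card_mono) (auto intro: rev_image_eqI)
    also have "\<dots> = 2 * card (fst ` J)" by (simp add: card_cartesian_product)
    also have "\<dots> \<le> card (fst ` J <#> K)" by (rule K2[OF F])
    also have "fst ` J <#> K = (\<Union>p\<in>J. A p)" by (auto simp: set_mult_def A_def)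
    finally show ?thesis .
  qed simp
  have finA: "finite (A p)" for p using K by (simp add: A_def)
  obtain m where m: "inj_on m ?I" "\<And>p. p \<in> ?I \<Longrightarrow> m p \<in> A p"
    by (rule hall_transversal[of ?I A, OF finA hall]) auto
  have "\<forall>p\<in>?I. \<exists>k. k \<in> K \<and> m p = fst p \<otimes> k"
  proof
    fix p assume "p \<in> ?I"
    from m(2)[OF this] show "\<exists>k. k \<in> K \<and> m p = fst p \<otimes> k" by (auto simp: A_def)
  qed
  from bchoice[OF this] obtain k where k0: "\<forall>p\<in>?I. k p \<in> K \<and> m p = fst p \<otimes> k p" by (rule exE)
  have k: "k p \<in> K" "m p = fst p \<otimes> k p" if "p \<in> ?I" for p
    using bspec[OF k0 that] by simp_all
  from am[unfolded right_amenable_def] obtain \<mu> :: "'a set \<Rightarrow> real" where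
    \<mu>1: "\<forall>A. A \<subseteq> carrier G \<longrightarrow> 0 \<le> \<mu> A \<and> \<mu> A \<le> 1" and one: "\<mu> (carrier G) = 1" and
    \<mu>2: "\<forall>A B. A \<subseteq> carrier G \<longrightarrow> B \<subseteq> carrier G \<longrightarrow> A \<inter> B = {} \<longrightarrow> \<mu> (A \<union> B) = \<mu> A + \<mu> B" and
    \<mu>3: "\<forall>s\<in>carrier G. \<forall>A. A \<subseteq> carrier G \<longrightarrow> \<mu> {x \<in> carrier G. x \<otimes> s \<in> A} = \<mu> A"
    by (elim exE conjE)
  note pos = \<mu>1[rule_format] and add = \<mu>2[rule_format] and inv = \<mu>3[rule_format]
  have mu_empty: "\<mu> {} = 0" using add[of "{}" "{}"] by simp
  have mu_UN: "\<mu> (\<Union>j\<in>J. X j) = (\<Sum>j\<in>J. \<mu> (X j))"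
    if "finite J" "\<And>j. j \<in> J \<Longrightarrow> X j \<subseteq> carrier G"
      "\<And>i j. i \<in> J \<Longrightarrow> j \<in> J \<Longrightarrow> i \<noteq> j \<Longrightarrow> X i \<inter> X j = {}"
    for J :: "(bool \<times> 'a) set" and X
    using that
  proof (induction J rule: finite_induct)
    case (insert j J)
    have "\<mu> (X j \<union> (\<Union>j\<in>J. X j)) = \<mu> (X j) + \<mu> (\<Union>j\<in>J. X j)"
      using insert.prems insert.hyps by (intro add) blast+
    then show ?case using insert by simp
  qed (simp add: mu_empty)
  \<comment> \<open>\<open>B (i, c)\<close> is the part of copy \<open>i\<close> that the matching
    moves by \<open>c\<close>. For fixed \<open>i\<close> these parts partition the carrier, while
    the translates of all parts of both copies are pairwise disjoint.\<close>
  define B where "B q = {x \<in> carrier G. k (x, fst q) = snd q}" for q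
  have Bc: "B q \<subseteq> carrier G" for q by (auto simp: B_def)
  have BK: "B q #> snd q \<subseteq> carrier G" if "snd q \<in> K" for q
    using that K(2) Bc[of q] by (auto simp: r_coset_def subset_iff)
  have shift: "\<mu> (B q #> snd q) = \<mu> (B q)" if "snd q \<in> K" for q
  proof -
    have q: "snd q \<in> carrier G" using that K by blast
    \<comment> \<open>Right cancellation makes \<open>B q\<close> the full preimage of its
      translate, so invariance of \<open>\<mu>\<close> under preimages equates the two
      masses.\<close>
    have "{x \<in> carrier G. x \<otimes> snd q \<in> B q #> snd q} = B q"
      using q Bc[of q] by (auto simp: r_coset_def dest!: r_cancel')
    then show ?thesis using inv[OF q BK[OF that]] by simp
  qed
  have "(\<Sum>q\<in>UNIV \<times> K. \<mu> (B q #> snd q)) = \<mu> (\<Union>q\<in>UNIV \<times> K. B q #> snd q)"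
  proof (rule mu_UN[symmetric])
    fix q r :: "bool \<times> 'a" assume qr: "q \<in> UNIV \<times> K" "r \<in> UNIV \<times> K" "q \<noteq> r"
    show "(B q #> snd q) \<inter> (B r #> snd r) = {}"
    proof (rule ccontr)
      assume "\<not> ?thesis"
      then obtain x y where xy: "x \<in> B q" "y \<in> B r" "x \<otimes> snd q = y \<otimes> snd r"
        by (auto simp: r_coset_def)
      have "m (x, fst q) = m (y, fst r)" using xy k(2) by (simp add: B_def)
      then have "x = y \<and> fst q = fst r"
        using m(1) xy by (auto simp: B_def dest!: inj_onD)
      then have "q = r" using xy by (auto simp: B_def prod_eq_iff)
      then show False using qr by blast
    qed
  next
    fix q :: "bool \<times> 'a" assume "q \<in> UNIV \<times> K"
    then show "B q #> snd q \<subseteq> carrier G" by (intro BK) auto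
  qed (use K in simp)
  also have "\<dots> \<le> 1"
  proof (intro pos[THEN conjunct2] UN_least)
    fix q :: "bool \<times> 'a" assume "q \<in> UNIV \<times> K"
    then show "B q #> snd q \<subseteq> carrier G" by (intro BK) auto
  qed
  also have "(\<Sum>q\<in>UNIV \<times> K. \<mu> (B q #> snd q)) = (\<Sum>q\<in>UNIV \<times> K. \<mu> (B q))"
    by (intro sum.cong refl shift) auto
  finally have le: "(\<Sum>q\<in>UNIV \<times> K. \<mu> (B q)) \<le> 1" .
  \<comment> \<open>Each copy has total mass 1, against the bound \<open>le\<close> for both copies
    together.\<close>
  have part: "(\<Sum>c\<in>K. \<mu> (B (i, c))) = 1" for i
  proof -
    have "(\<Sum>c\<in>K. \<mu> (B (i, c))) = (\<Sum>q\<in>{i} \<times> K. \<mu> (B q))"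
      by (rule sum.reindex_bij_witness[of _ snd "Pair i"]) auto
    also have "\<dots> = \<mu> (\<Union>q\<in>{i} \<times> K. B q)"
      using K Bc by (intro mu_UN[symmetric]) (auto simp: B_def)
    also have "(\<Union>q\<in>{i} \<times> K. B q) = carrier G" using k(1) by (auto simp: B_def)
    also note one
    finally show ?thesis .
  qed
  have "(\<Sum>q\<in>UNIV \<times> K. \<mu> (B q)) = (\<Sum>i\<in>(UNIV :: bool set). \<Sum>c\<in>K. \<mu> (B (i, c)))"
    by (simp add: sum.cartesian_product)
  also have "\<dots> = 2" by (simp add: part)
  finally show False using le by simp
qed

subsection \<open>Quasi-tilings\<close>

lemma finite_l_coset: "finite K \<Longrightarrow> finite (s <# K)"
  by (simp add: l_coset_def)

lemma l_coset_closed: "s \<in> carrier G \<Longrightarrow> K \<subseteq> carrier G \<Longrightarrow> s <# K \<subseteq> carrier G"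
  by (auto simp: l_coset_def)

lemma card_l_coset:
  assumes "s \<in> carrier G" "K \<subseteq> carrier G"
  shows "card (s <# K) = card K"
proof -
  have "s <# K = (\<lambda>x. s \<otimes> x) ` K" by (auto simp: l_coset_def)
  then show ?thesis using inj_left[OF assms] by (simp add: card_image)
qed

text \<open>By associativity left translation commutes with right multiplication, so
  \<open>t y\<close> can leave the union under \<open>s\<close> only if \<open>y\<close> leaves
  \<open>K\<close>.\<close>

lemma card_escape_l_coset_Union:
  assumes T: "finite T" "T \<subseteq> carrier G" and K: "finite K" "K \<subseteq> carrier G" and s: "s \<in> carrier G"
  shows "card {x \<in> (\<Union>t\<in>T. t <# K). x \<otimes> s \<notin> (\<Union>t\<in>T. t <# K)} \<le> card T * card {x \<in> K. x \<otimes> s \<notin> K}"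
proof -
  let ?D = "{x \<in> K. x \<otimes> s \<notin> K}"
  have "{x \<in> (\<Union>t\<in>T. t <# K). x \<otimes> s \<notin> (\<Union>t\<in>T. t <# K)} \<subseteq> (\<Union>t\<in>T. t <# ?D)"
  proof
    fix x assume x: "x \<in> {x \<in> (\<Union>t\<in>T. t <# K). x \<otimes> s \<notin> (\<Union>t\<in>T. t <# K)}"
    then obtain t y where ty: "t \<in> T" "y \<in> K" "x = t \<otimes> y" by (auto simp: l_coset_def)
    then have c: "x \<otimes> s = t \<otimes> (y \<otimes> s)" using T K s by (auto simp: m_assoc subset_iff)
    have "y \<otimes> s \<notin> K"
    proof
      assume "y \<otimes> s \<in> K"
      then have "x \<otimes> s \<in> t <# K" unfolding c by (auto simp: l_coset_def)
      then show False using x ty by blast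
    qed
    then show "x \<in> (\<Union>t\<in>T. t <# ?D)" using ty by (auto simp: l_coset_def)
  qed
  then have "card {x \<in> (\<Union>t\<in>T. t <# K). x \<otimes> s \<notin> (\<Union>t\<in>T. t <# K)} \<le> card (\<Union>t\<in>T. t <# ?D)"
    using T K by (intro card_mono) (auto simp: l_coset_def)
  also have "\<dots> \<le> (\<Sum>t\<in>T. card (t <# ?D))" using T by (intro card_UN_le)
  also have "\<dots> \<le> (\<Sum>t\<in>T. card ?D)"
  proof (rule sum_mono)
    fix t assume "t \<in> T"
    then show "card (t <# ?D) \<le> card ?D" using T K by (subst card_l_coset) auto
  qed
  finally show ?thesis by simp
qed

text \<open>Double counting of the pairs \<open>(s, k)\<close> with \<open>s k\<close> in
  \<open>U\<close>: left cancellation identifies them with the points of the intersections, and by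
  right cancellation each \<open>k\<close> admits at most \<open>card U\<close> values of
  \<open>s\<close>.\<close>

lemma sum_card_l_coset_Int_le:
  assumes W: "finite W" "W \<subseteq> carrier G" and K: "finite K" "K \<subseteq> carrier G"
    and U: "finite U" "U \<subseteq> carrier G"
  shows "(\<Sum>s\<in>W. card ((s <# K) \<inter> U)) \<le> card K * card U"
proof -
  have "card ((s <# K) \<inter> U) = card {k \<in> K. s \<otimes> k \<in> U}" if "s \<in> W" for s
  proof -
    have "(s <# K) \<inter> U = (\<lambda>k. s \<otimes> k) ` {k \<in> K. s \<otimes> k \<in> U}" by (auto simp: l_coset_def)
    moreover have "inj_on (\<lambda>k. s \<otimes> k) {k \<in> K. s \<otimes> k \<in> U}"
      using that W K by (intro inj_left) auto
    ultimately show ?thesis by (simp add: card_image)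
  qed
  then have "(\<Sum>s\<in>W. card ((s <# K) \<inter> U)) = (\<Sum>s\<in>W. \<Sum>k\<in>K. if s \<otimes> k \<in> U then 1 else 0)"
    using K by (simp add: sum.If_cases Int_def)
  also have "\<dots> = (\<Sum>k\<in>K. card {s \<in> W. s \<otimes> k \<in> U})"
    using W by (subst sum.swap) (simp add: sum.If_cases Int_def)
  also have "\<dots> \<le> (\<Sum>k\<in>K. card U)"
  proof (rule sum_mono)
    fix k assume "k \<in> K"
    then show "card {s \<in> W. s \<otimes> k \<in> U} \<le> card U"
      using W K U by (intro card_inj_on_le[of "\<lambda>s. s \<otimes> k"] inj_right) auto
  qed
  finally show ?thesis by simp
qed

text \<open>As right multiplication by \<open>s\<close> is injective, at most \<open>card U\<close>
  points of \<open>F\<close> land in \<open>U\<close>. Subtracting the points of \<open>U\<close>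
  that stay in \<open>U\<close> leaves the number of escapes. This takes the place of an argument
  with the inverse of \<open>s\<close>.\<close>

lemma card_entering_le_escape:
  assumes F: "finite F" "F \<subseteq> carrier G" and U: "U \<subseteq> F" and s: "s \<in> carrier G"
  shows "card {x \<in> F - U. x \<otimes> s \<in> U} \<le> card {x \<in> U. x \<otimes> s \<notin> U}"
proof -
  have fU: "finite U" using F U finite_subset by blast
  have "card {x \<in> F. x \<otimes> s \<in> U} \<le> card U"
    using F fU s by (intro card_inj_on_le[of "\<lambda>x. x \<otimes> s"] inj_right) auto
  also have "card U = card {x \<in> U. x \<otimes> s \<in> U} + card {x \<in> U. x \<otimes> s \<notin> U}"
    using fU by (subst card_Un_disjoint[symmetric]) (auto intro: arg_cong[of _ _ card])
  also have "card {x \<in> F. x \<otimes> s \<in> U} = card {x \<in> U. x \<otimes> s \<in> U} + card {x \<in> F - U. x \<otimes> s \<in> U}"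
    using F U fU by (subst card_Un_disjoint[symmetric]) (auto intro!: arg_cong[of _ _ card])
  finally show ?thesis by simp
qed

text \<open>A largest set \<open>T\<close> of almost disjoint translates meets every translate \<open>s K\<close> in a fraction of at
  least \<open>e\<close>; since right cancellation lets every point lie in at most \<open>|K|\<close> of these translates, the
  union is large.\<close>

lemma greedy_tiling:
  assumes W: "finite W" "W \<subseteq> carrier G" and K: "K \<in> fin_subsets G" and e: "0 < e" "e < 1"
  obtains T where "T \<subseteq> W" "(1 - e) * real (card K) * real (card T) \<le> real (card (\<Union>t\<in>T. t <# K))"
    "e * real (card W) \<le> real (card (\<Union>t\<in>T. t <# K))"
proof -
  have K': "finite K" "K \<subseteq> carrier G" "card K > 0"
    using K by (auto simp: fin_subsets_def card_gt_0_iff)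
  define U where "U T = (\<Union>t\<in>T. t <# K)" for T
  define P where "P T \<longleftrightarrow> T \<subseteq> W \<and> (1 - e) * real (card K) * real (card T) \<le> real (card (U T))" for T
  have "P {}" by (simp add: P_def)
  moreover have "\<forall>T. P T \<longrightarrow> card T < Suc (card W)" using W by (auto simp: P_def less_Suc_eq_le card_mono)
  ultimately have "\<exists>T. P T \<and> (\<forall>T'. P T' \<longrightarrow> card T' \<le> card T)"
    by (rule ex_has_greatest_nat)
  then obtain T where T: "P T" and greatest: "\<forall>T'. P T' \<longrightarrow> card T' \<le> card T"
    by (elim exE conjE)
  have TW: "T \<subseteq> W" "finite T" using T W by (auto simp: P_def finite_subset)
  have finU: "finite (U T)" and Uc: "U T \<subseteq> carrier G"
    using TW W K' by (auto simp: U_def l_coset_def)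
  \<comment> \<open>If \<open>s K\<close> met the union in fewer than \<open>e |K|\<close> points,
    adding \<open>s\<close> to \<open>T\<close> would contribute more than
    \<open>(1 - e) |K|\<close> new points, so \<open>T\<close> would not be largest.\<close>
  have big: "e * real (card K) \<le> real (card ((s <# K) \<inter> U T))" if s: "s \<in> W" for s
  proof (rule ccontr)
    assume neg: "\<not> ?thesis"
    have cs: "card (s <# K) = card K" using s W K' by (intro card_l_coset) auto
    have fs: "finite (s <# K)" using K' by (simp add: finite_l_coset)
    have "s \<notin> T"
    proof
      assume "s \<in> T"
      then have "(s <# K) \<inter> U T = s <# K" by (auto simp: U_def)
      moreover have "e * real (card K) \<le> 1 * real (card K)" using e by (intro mult_right_mono) auto
      ultimately show False using neg cs by simp
    qed
    have "card (U T \<union> (s <# K)) + card ((s <# K) \<inter> U T) = card (U T) + card K"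
      using card_Un_Int[OF finU fs] cs by (simp add: Int_commute)
    then have "real (card (U T \<union> (s <# K))) + real (card ((s <# K) \<inter> U T)) = real (card (U T)) + real (card K)"
      by (metis of_nat_add)
    moreover have "U (insert s T) = U T \<union> (s <# K)" by (auto simp: U_def)
    ultimately have "P (insert s T)"
      using T neg s \<open>s \<notin> T\<close> TW unfolding P_def by (simp add: algebra_simps)
    then show False using greatest[rule_format, of "insert s T"] \<open>s \<notin> T\<close> TW by simp
  qed
  \<comment> \<open>Summing \<open>big\<close> over \<open>W\<close> and double counting gives
    \<open>|K| e |W| \<le> |K| |U T|\<close>, and \<open>|K|\<close> cancels.\<close>
  have "real (card K) * (e * real (card W)) = (\<Sum>s\<in>W. e * real (card K))" by simp
  also have "\<dots> \<le> (\<Sum>s\<in>W. real (card ((s <# K) \<inter> U T)))" by (rule sum_mono[OF big])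
  also have "\<dots> = real (\<Sum>s\<in>W. card ((s <# K) \<inter> U T))" by simp
  also have "\<dots> \<le> real (card K * card (U T))"
    using sum_card_l_coset_Int_le[OF W K'(1,2) finU Uc] by (rule of_nat_mono)
  finally have "e * real (card W) \<le> real (card (U T))" using K' by simp
  then show thesis using that[of T] T by (simp add: P_def U_def)
qed

end

section \<open>Subadditive functions on tilings and the existence of limits\<close>

definition zero_extend :: "('a set \<Rightarrow> real) \<Rightarrow> 'a set \<Rightarrow> real" where
  "zero_extend f A = (if A = {} then 0 else f A)"

lemma subadd_functionsD:
  assumes "f \<in> subadd_functions G"
  shows subadd_nonneg: "\<And>F. F \<in> fin_subsets G \<Longrightarrow> 0 \<le> f F"
    and subadd_mono: "\<And>F F'. F \<in> fin_subsets G \<Longrightarrow> F' \<in> fin_subsets G \<Longrightarrow> F \<subseteq> F' \<Longrightarrow> f F \<le> f F'"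
    and subadd_Un: "\<And>F F'. F \<in> fin_subsets G \<Longrightarrow> F' \<in> fin_subsets G \<Longrightarrow> f (F \<union> F') \<le> f F + f F'"
    and subadd_l_coset: "\<And>s F. s \<in> carrier G \<Longrightarrow> F \<in> fin_subsets G \<Longrightarrow> f (s <#\<^bsub>G\<^esub> F) \<le> f F"
    and subadd_bounded: "\<exists>M\<ge>0. \<forall>s\<in>carrier G. f {s} \<le> M"
  using assms unfolding subadd_functions_def by simp_all

text \<open>Members of \<open>subadd_functions\<close> are unconstrained at the empty set, whereas
  tilings and remainders may be empty; the value 0 there keeps subadditivity.\<close>

lemma zero_extend_Un:
  assumes f: "f \<in> subadd_functions G"
    and "finite A" "A \<subseteq> carrier G" "finite B" "B \<subseteq> carrier G"
  shows "zero_extend f (A \<union> B) \<le> zero_extend f A + zero_extend f B"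
  using subadd_Un[OF f, of A B] assms(2-) by (simp add: zero_extend_def fin_subsets_def)

lemma zero_extend_UN:
  assumes f: "f \<in> subadd_functions G" and T: "finite T"
    and X: "\<And>t. t \<in> T \<Longrightarrow> finite (X t)" "\<And>t. t \<in> T \<Longrightarrow> X t \<subseteq> carrier G"
    and b: "\<And>t. t \<in> T \<Longrightarrow> zero_extend f (X t) \<le> b"
  shows "zero_extend f (\<Union>t\<in>T. X t) \<le> real (card T) * b"
  using T X b
proof (induction T rule: finite_induct)
  case (insert t T)
  have "zero_extend f (X t \<union> (\<Union>t\<in>T. X t)) \<le> zero_extend f (X t) + zero_extend f (\<Union>t\<in>T. X t)"
    using insert by (intro zero_extend_Un[OF f]) auto
  also have "\<dots> \<le> b + real (card T) * b" using insert by (intro add_mono) auto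
  finally show ?case using insert.hyps by (simp add: algebra_simps)
qed (simp add: zero_extend_def)

context cancellative_monoid
begin

text \<open>One round of tiling by translates of \<open>K\<close>. As \<open>F\<close> is very
  invariant under \<open>K\<close>, at least half of its points are admissible centres, and
  \<open>greedy_tiling\<close> covers a fraction \<open>e / 2\<close> of \<open>F\<close>. Almost
  disjointness turns the bound for \<open>f\<close> on \<open>K\<close> into one on
  \<open>U\<close>. The remainder stays almost invariant unless it is small, because leaving it
  means leaving \<open>F\<close> or entering a tile.\<close>

lemma tiling_scale_step:
  assumes f: "f \<in> subadd_functions G" and L: "L \<ge> 0"
    and e: "0 < e" "e < 1" and r: "0 < r" and d: "0 < d"
    and E: "E \<subseteq> carrier G"
    and K: "almost_invariant G E (d * r * (1 - e) / 2) K" "f K \<le> L * real (card K)"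
    and F: "almost_invariant G (E \<union> K) (min (d * r / 2) (1 / (2 * real (card K)))) F"
  obtains U where "U \<subseteq> F" "zero_extend f U \<le> L / (1 - e) * real (card U)"
    "real (card (F - U)) \<le> (1 - e / 2) * real (card F)"
    "real (card (F - U)) \<le> r * real (card F) \<or> almost_invariant G E d (F - U)"
proof -
  have F': "finite F" "F \<subseteq> carrier G" "card F > 0"
    using F by (auto simp: almost_invariant_def fin_subsets_def card_gt_0_iff)
  have Kf: "K \<in> fin_subsets G" using K by (simp add: almost_invariant_def)
  then have K': "finite K" "K \<subseteq> carrier G" "card K > 0"
    by (auto simp: fin_subsets_def card_gt_0_iff)
  define W where "W = {s \<in> F. s <# K \<subseteq> F}"
  have W: "finite W" "W \<subseteq> carrier G" using F' by (auto simp: W_def)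
  \<comment> \<open>A point of \<open>F\<close> outside \<open>W\<close> is moved out of
    \<open>F\<close> by some \<open>k \<in> K\<close>, and each \<open>k\<close> accounts for at
    most \<open>|F| / (2 |K|)\<close> points.\<close>
  have "card (F - W) \<le> card (\<Union>k\<in>K. {x \<in> F. x \<otimes> k \<notin> F})"
    using F' K' by (intro card_mono) (auto simp: W_def l_coset_def)
  also have "\<dots> \<le> (\<Sum>k\<in>K. card {x \<in> F. x \<otimes> k \<notin> F})" using K' by (intro card_UN_le)
  finally have "real (card (F - W)) \<le> (\<Sum>k\<in>K. real (card {x \<in> F. x \<otimes> k \<notin> F}))"
    by (simp flip: of_nat_sum)
  also have "\<dots> \<le> (\<Sum>k\<in>K. 1 / (2 * real (card K)) * real (card F))"
    using almost_invariant_mono[OF F, of K "1 / (2 * real (card K))"]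
    by (intro sum_mono) (auto simp: almost_invariant_def)
  also have "\<dots> = real (card F) / 2" using K' by auto
  finally have "real (card (F - W)) \<le> real (card F) / 2" .
  moreover have "card (F - W) = card F - card W"
    using F' by (intro card_Diff_subset) (auto simp: W_def)
  moreover have "card W \<le> card F" using F' by (intro card_mono) (auto simp: W_def)
  ultimately have Wbig: "real (card W) \<ge> real (card F) / 2" by (simp add: of_nat_diff)
  obtain T where T: "T \<subseteq> W" "(1 - e) * real (card K) * real (card T) \<le> real (card (\<Union>t\<in>T. t <# K))"
      "e * real (card W) \<le> real (card (\<Union>t\<in>T. t <# K))"
    using greedy_tiling[OF W Kf e] by auto
  have T': "finite T" "T \<subseteq> carrier G" using T(1) W finite_subset by auto
  define U where "U = (\<Union>t\<in>T. t <# K)"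
  have UF: "U \<subseteq> F" using T(1) by (auto simp: U_def W_def)
  have fU: "finite U" using UF F' finite_subset by blast
  have cardU: "card U \<le> card F" using UF F' by (intro card_mono)
  have cardR: "real (card (F - U)) = real (card F) - real (card U)"
    using UF fU cardU by (simp add: card_Diff_subset of_nat_diff)
  have "real (card K) * real (card T) \<le> real (card U) / (1 - e)"
    using T(2) e by (simp add: U_def pos_le_divide_eq algebra_simps)
  note KT = this
  have "zero_extend f U \<le> real (card T) * (L * real (card K))"
    unfolding U_def
  proof (rule zero_extend_UN[OF f T'(1)])
    fix t assume "t \<in> T"
    then have t: "t \<in> carrier G" using T' by blast
    show "finite (t <# K)" using K' by (intro finite_l_coset)
    show "t <# K \<subseteq> carrier G" using t K' by (intro l_coset_closed)
    have "zero_extend f (t <# K) \<le> f K"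
      using subadd_l_coset[OF f t Kf] subadd_nonneg[OF f Kf] by (simp add: zero_extend_def)
    also note K(2)
    finally show "zero_extend f (t <# K) \<le> L * real (card K)" .
  qed
  also have "\<dots> = L * (real (card K) * real (card T))" by simp
  also have "\<dots> \<le> L * (real (card U) / (1 - e))" by (intro mult_left_mono KT L)
  finally have 1: "zero_extend f U \<le> L / (1 - e) * real (card U)" by simp
  have "e * (real (card F) / 2) \<le> e * real (card W)" using Wbig e by (intro mult_left_mono) auto
  also have "\<dots> \<le> real (card U)" using T(3) by (simp add: U_def)
  finally have 2: "real (card (F - U)) \<le> (1 - e / 2) * real (card F)"
    unfolding cardR by (simp add: algebra_simps)
  \<comment> \<open>The tolerances for \<open>F\<close> and \<open>K\<close> are chosen so that
    either source of escapes contributes at most \<open>d r |F| / 2\<close>; the sum is below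
    \<open>d |F - U|\<close> when the remainder exceeds \<open>r |F|\<close>.\<close>
  have 3: "almost_invariant G E d (F - U)" if big: "real (card (F - U)) > r * real (card F)"
    unfolding almost_invariant_def
  proof (intro conjI ballI)
    have "r * real (card F) > 0" using r F' by simp
    then have "F - U \<noteq> {}" using big by force
    then show "F - U \<in> fin_subsets G" using F' by (auto simp: fin_subsets_def)
    fix s assume s: "s \<in> E"
    then have sc: "s \<in> carrier G" using E by blast
    have "card {x \<in> F - U. x \<otimes> s \<notin> F - U} \<le> card ({x \<in> F. x \<otimes> s \<notin> F} \<union> {x \<in> F - U. x \<otimes> s \<in> U})"
      using F' by (intro card_mono) auto
    also have "\<dots> \<le> card {x \<in> F. x \<otimes> s \<notin> F} + card {x \<in> F - U. x \<otimes> s \<in> U}"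
      by (rule card_Un_le)
    also have "card {x \<in> F - U. x \<otimes> s \<in> U} \<le> card {x \<in> U. x \<otimes> s \<notin> U}"
      by (rule card_entering_le_escape[OF F'(1,2) UF sc])
    also have "\<dots> \<le> card T * card {x \<in> K. x \<otimes> s \<notin> K}"
      unfolding U_def by (rule card_escape_l_coset_Union[OF T' K'(1,2) sc])
    finally have "real (card {x \<in> F - U. x \<otimes> s \<notin> F - U}) \<le>
        real (card {x \<in> F. x \<otimes> s \<notin> F}) + real (card T) * real (card {x \<in> K. x \<otimes> s \<notin> K})"
      by (simp flip: of_nat_mult of_nat_add)
    also have "\<dots> \<le> d * r / 2 * real (card F) + real (card T) * (d * r * (1 - e) / 2 * real (card K))"
    proof (intro add_mono mult_left_mono)
      show "real (card {x \<in> F. x \<otimes> s \<notin> F}) \<le> d * r / 2 * real (card F)"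
        using almost_invariant_mono[OF F, of "{s}" "d * r / 2"] s by (simp add: almost_invariant_def)
      show "real (card {x \<in> K. x \<otimes> s \<notin> K}) \<le> d * r * (1 - e) / 2 * real (card K)"
        using K(1) s unfolding almost_invariant_def by blast
    qed simp
    also have "real (card T) * (d * r * (1 - e) / 2 * real (card K)) =
        d * r / 2 * ((1 - e) * real (card K) * real (card T))" by simp
    also have "\<dots> \<le> d * r / 2 * real (card F)"
      using T(2) cardU d r by (intro mult_left_mono) (auto simp: U_def)
    finally have "real (card {x \<in> F - U. x \<otimes> s \<notin> F - U}) \<le> d * (r * real (card F))" by simp
    also have "\<dots> \<le> d * real (card (F - U))" using big d by (intro mult_left_mono) auto
    finally show "real (card {x \<in> F - U. x \<otimes> s \<notin> F - U}) \<le> d * real (card (F - U))" .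
  qed
  show thesis by (rule that[OF UF 1 2]) (use 3 in linarith)
qed

text \<open>Induction on the number of rounds, each leaving at most a fraction
  \<open>1 - e / 2\<close>; the maximum with \<open>r\<close> accounts for stopping once the
  remainder is small. The later rounds fix \<open>E\<close> and \<open>d\<close> first, and the tile
  of the current round is then taken invariant enough for its remainder to qualify. The tile used
  first is thus chosen last.\<close>

lemma tiling_scales:
  assumes f: "f \<in> subadd_functions G" and L: "L \<ge> 0"
    and low: "\<And>E d. finite E \<Longrightarrow> E \<subseteq> carrier G \<Longrightarrow> d > 0 \<Longrightarrow>
      \<exists>K. almost_invariant G E d K \<and> f K \<le> L * real (card K)"
    and e: "0 < e" "e < 1" and r: "0 < r"
  shows "\<exists>E d. finite E \<and> E \<subseteq> carrier G \<and> d > 0 \<and> (\<forall>F. almost_invariant G E d F \<longrightarrow>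
    (\<exists>U\<subseteq>F. zero_extend f U \<le> L / (1 - e) * real (card U) \<and>
       real (card (F - U)) \<le> max r ((1 - e / 2) ^ n) * real (card F)))"
proof (induction n)
  case 0
  have "real (card F) \<le> max r 1 * real (card F)" for F :: "'a set"
    using mult_right_mono[of 1 "max r 1" "real (card F)"] by simp
  then show ?case
    by (intro exI[of _ "{}"] exI[of _ 1]) (auto intro!: exI[of _ "{}"] simp: zero_extend_def)
next
  case (Suc n)
  then obtain E d where E: "finite E" "E \<subseteq> carrier G" and d: "d > 0"
    and IH: "\<And>F. almost_invariant G E d F \<Longrightarrow> \<exists>U\<subseteq>F. zero_extend f U \<le> L / (1 - e) * real (card U) \<and>
       real (card (F - U)) \<le> max r ((1 - e / 2) ^ n) * real (card F)"
    by (elim exE conjE) simp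
  have "d * r * (1 - e) / 2 > 0" using d r e by simp
  from low[OF E this] obtain K where K: "almost_invariant G E (d * r * (1 - e) / 2) K"
    "f K \<le> L * real (card K)" by (elim exE conjE)
  have K': "finite K" "K \<subseteq> carrier G" "card K > 0"
    using K(1) by (auto simp: almost_invariant_def fin_subsets_def card_gt_0_iff)
  let ?d = "min (d * r / 2) (1 / (2 * real (card K)))"
  have "\<exists>U\<subseteq>F. zero_extend f U \<le> L / (1 - e) * real (card U) \<and>
       real (card (F - U)) \<le> max r ((1 - e / 2) ^ Suc n) * real (card F)"
    if F: "almost_invariant G (E \<union> K) ?d F" for F
  proof -
    have F': "finite F" "F \<subseteq> carrier G"
      using F by (auto simp: almost_invariant_def fin_subsets_def)
    obtain U where U: "U \<subseteq> F" "zero_extend f U \<le> L / (1 - e) * real (card U)"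
      "real (card (F - U)) \<le> (1 - e / 2) * real (card F)"
      "real (card (F - U)) \<le> r * real (card F) \<or> almost_invariant G E d (F - U)"
      by (rule tiling_scale_step[OF f L e r d E(2) K F])
    from U(4) show ?thesis
    proof
      assume "real (card (F - U)) \<le> r * real (card F)"
      also have "\<dots> \<le> max r ((1 - e / 2) ^ Suc n) * real (card F)" by (intro mult_right_mono) auto
      finally show ?thesis using U(1,2) by blast
    next
      assume "almost_invariant G E d (F - U)"
      from IH[OF this] obtain V where V: "V \<subseteq> F - U" "zero_extend f V \<le> L / (1 - e) * real (card V)"
        "real (card (F - U - V)) \<le> max r ((1 - e / 2) ^ n) * real (card (F - U))"
        by (elim exE conjE)
      have fin: "finite U" "finite V" using U(1) V(1) F' by (auto intro: finite_subset)
      have "zero_extend f (U \<union> V) \<le> zero_extend f U + zero_extend f V"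
        using fin U(1) V(1) F' by (intro zero_extend_Un[OF f]) auto
      also have "\<dots> \<le> L / (1 - e) * (real (card U) + real (card V))"
        using U(2) V(2) by (simp add: distrib_left)
      also have "real (card U) + real (card V) = real (card (U \<union> V))"
        using fin V(1) by (subst card_Un_disjoint) auto
      finally have 1: "zero_extend f (U \<union> V) \<le> L / (1 - e) * real (card (U \<union> V))" .
      \<comment> \<open>The term with \<open>r\<close> needs only \<open>|F - U| \<le> |F|\<close>;
        the power gains its extra factor from the bound of the first round.\<close>
      have "max r ((1 - e / 2) ^ n) * real (card (F - U)) =
          max (r * real (card (F - U))) ((1 - e / 2) ^ n * real (card (F - U)))"
        by (simp add: max_mult_distrib_right)
      also have "\<dots> \<le> max (r * real (card F)) ((1 - e / 2) ^ n * ((1 - e / 2) * real (card F)))"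
        using U(3) F' r e by (intro max.mono mult_left_mono) (auto intro: card_mono)
      also have "\<dots> = max r ((1 - e / 2) ^ Suc n) * real (card F)"
        by (simp add: max_mult_distrib_right max_mult_distrib_left ac_simps)
      finally have "real (card (F - (U \<union> V))) \<le> max r ((1 - e / 2) ^ Suc n) * real (card F)"
        using V(3) by (simp add: set_diff_eq conj_assoc)
      moreover have "U \<union> V \<subseteq> F" using U(1) V(1) by blast
      ultimately show ?thesis using 1 by blast
    qed
  qed
  moreover have "?d > 0" using d r K' by simp
  moreover have "finite (E \<union> K)" "E \<union> K \<subseteq> carrier G" using E K' by auto
  ultimately show ?case by blast
qed

text \<open>\<open>low\<close> provides tiles of mean at most \<open>L\<close>, as invariant as
  desired. On the part of \<open>F\<close> that they cover the bound loses a factor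
  \<open>1 / (1 - e)\<close>, and the at most \<open>r |F|\<close> uncovered points cost at most
  \<open>M\<close> each.\<close>

lemma eventually_le_of_low:
  assumes f: "f \<in> subadd_functions G"
    and low: "\<And>E d. finite E \<Longrightarrow> E \<subseteq> carrier G \<Longrightarrow> d > 0 \<Longrightarrow>
      \<exists>K. almost_invariant G E d K \<and> f K \<le> L * real (card K)"
    and h: "h > 0"
  obtains E d where "finite E" "E \<subseteq> carrier G" "d > 0"
    "\<And>F. almost_invariant G E d F \<Longrightarrow> f F \<le> (L + h) * real (card F)"
proof -
  obtain K where K: "almost_invariant G {} 1 K" "f K \<le> L * real (card K)"
    using low[of "{}" 1] by auto
  have "0 \<le> L * real (card K)" using K subadd_nonneg[OF f, of K] by (simp add: almost_invariant_def)
  then have L: "L \<ge> 0" using almost_invariant_card_pos[OF K(1)] by (simp add: zero_le_mult_iff)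
  obtain M where M: "M \<ge> 0" "\<And>s. s \<in> carrier G \<Longrightarrow> f {s} \<le> M"
    using subadd_bounded[OF f] by auto
  \<comment> \<open>The error is split in halves: \<open>e\<close> yields
    \<open>L / (1 - e) \<le> L + h / 2\<close> and \<open>r\<close> yields
    \<open>M r \<le> h / 2\<close>, with \<open>M + 1\<close> guarding against
    \<open>M = 0\<close>.\<close>
  define e where "e = h / (2 * (L + h))"
  define r where "r = h / (2 * (M + 1))"
  have e: "0 < e" "e < 1" using L h by (auto simp: e_def divide_simps)
  have r: "0 < r" using M h by (simp add: r_def)
  have "1 - e = (2 * L + h) / (2 * (L + h))" using L h by (simp add: e_def field_simps)
  then have "L / (1 - e) = L * (2 * (L + h)) / (2 * L + h)" by simp
  also have "\<dots> \<le> L + h / 2"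
    using L h by (simp add: pos_divide_le_eq algebra_simps)
  finally have Le: "L / (1 - e) \<le> L + h / 2" .
  have Mr: "M * r \<le> h / 2" using M h by (simp add: r_def field_simps)
  obtain n where n: "(1 - e / 2) ^ n < r" using real_arch_pow_inv[of r "1 - e / 2"] r e by auto
  have "\<exists>E d. finite E \<and> E \<subseteq> carrier G \<and> d > 0 \<and> (\<forall>F. almost_invariant G E d F \<longrightarrow>
    (\<exists>U\<subseteq>F. zero_extend f U \<le> L / (1 - e) * real (card U) \<and>
       real (card (F - U)) \<le> max r ((1 - e / 2) ^ n) * real (card F)))"
    by (rule tiling_scales[OF f L _ e r]) (rule low)
  then obtain E d where E: "finite E" "E \<subseteq> carrier G" "d > 0"
    and tile: "\<And>F. almost_invariant G E d F \<Longrightarrow> \<exists>U\<subseteq>F. zero_extend f U \<le> L / (1 - e) * real (card U) \<and>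
       real (card (F - U)) \<le> max r ((1 - e / 2) ^ n) * real (card F)"
    by (elim exE conjE) simp
  have "f F \<le> (L + h) * real (card F)" if F: "almost_invariant G E d F" for F
  proof -
    have F': "finite F" "F \<subseteq> carrier G" "F \<noteq> {}"
      using F by (auto simp: almost_invariant_def fin_subsets_def)
    from tile[OF F] obtain U where U: "U \<subseteq> F" "zero_extend f U \<le> L / (1 - e) * real (card U)"
       "real (card (F - U)) \<le> max r ((1 - e / 2) ^ n) * real (card F)" by (elim exE conjE)
    have "zero_extend f (\<Union>s\<in>F - U. {s}) \<le> real (card (F - U)) * M"
      using F' M by (intro zero_extend_UN[OF f]) (auto simp: zero_extend_def subset_iff)
    also have "\<dots> \<le> r * real (card F) * M" using U(3) n M by (intro mult_right_mono) auto
    also have "\<dots> = M * r * real (card F)" by simp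
    also have "\<dots> \<le> h / 2 * real (card F)" by (intro mult_right_mono Mr) auto
    finally have 1: "zero_extend f (F - U) \<le> h / 2 * real (card F)" by simp
    have "real (card U) \<le> real (card F)" using U(1) F' by (simp add: card_mono)
    then have "L / (1 - e) * real (card U) \<le> (L + h / 2) * real (card F)"
      using Le L h by (intro mult_mono) auto
    with U(2) have 2: "zero_extend f U \<le> (L + h / 2) * real (card F)" by linarith
    have "U \<union> (F - U) = F" using U(1) by blast
    then have "f F = zero_extend f (U \<union> (F - U))" using F' by (simp add: zero_extend_def)
    also have "\<dots> \<le> zero_extend f U + zero_extend f (F - U)"
      using U(1) F' by (intro zero_extend_Un[OF f]) (auto intro: finite_subset)
    also have "\<dots> \<le> (L + h) * real (card F)" using 1 2 by (simp add: algebra_simps)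
    finally show ?thesis .
  qed
  then show thesis using that E by blast
qed

text \<open>The infimum \<open>L\<close> of the numbers satisfying \<open>low\<close> is the lower
  limit of the means. All sufficiently invariant sets have mean at most slightly above
  \<open>L\<close> by \<open>eventually_le_of_low\<close>, and at least slightly below it because
  smaller numbers are not \<open>low\<close>.\<close>

lemma ornstein_weiss:
  assumes ex: "\<And>E d. finite E \<Longrightarrow> E \<subseteq> carrier G \<Longrightarrow> d > 0 \<Longrightarrow> \<exists>F. almost_invariant G E d F"
    and f: "f \<in> subadd_functions G"
  obtains L where "folner_limit G f L"
proof -
  define low where "low l \<longleftrightarrow> (\<forall>E d. finite E \<longrightarrow> E \<subseteq> carrier G \<longrightarrow> d > 0 \<longrightarrow>
    (\<exists>K. almost_invariant G E d K \<and> f K \<le> l * real (card K)))" for l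
  have lowD: "\<exists>K. almost_invariant G E d K \<and> f K \<le> l * real (card K)"
    if "low l" "finite E" "E \<subseteq> carrier G" "d > 0" for l E d
    using that unfolding low_def by simp
  obtain M where M: "M \<ge> 0" "\<And>s. s \<in> carrier G \<Longrightarrow> f {s} \<le> M"
    using subadd_bounded[OF f] by auto
  \<comment> \<open>Splitting a set into singletons shows that the uniform bound \<open>M\<close>
    qualifies, so the infimum is over a non-empty set.\<close>
  have "low M" unfolding low_def
  proof (intro allI impI)
    fix E :: "'a set" and d :: real assume "finite E" "E \<subseteq> carrier G" "d > 0"
    then have "\<exists>K. almost_invariant G E d K" by (rule ex)
    then obtain K where K: "almost_invariant G E d K" by (elim exE)
    then have K': "finite K" "K \<subseteq> carrier G" "K \<noteq> {}"
      by (auto simp: almost_invariant_def fin_subsets_def)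
    have "zero_extend f (\<Union>s\<in>K. {s}) \<le> real (card K) * M"
      using K' M by (intro zero_extend_UN[OF f]) (auto simp: zero_extend_def subset_iff)
    then have "f K \<le> M * real (card K)" using K' by (simp add: zero_extend_def mult.commute)
    with K show "\<exists>K. almost_invariant G E d K \<and> f K \<le> M * real (card K)" by blast
  qed
  have low_nonneg: "l \<ge> 0" if low_l: "low l" for l
  proof -
    obtain K where K: "almost_invariant G {} 1 K" "f K \<le> l * real (card K)"
      using lowD[OF low_l, of "{}" 1] by auto
    have "0 \<le> l * real (card K)" using K subadd_nonneg[OF f, of K] by (simp add: almost_invariant_def)
    then show ?thesis using almost_invariant_card_pos[OF K(1)] by (simp add: zero_le_mult_iff)
  qed
  define L where "L = Inf (Collect low)"
  have bdd: "bdd_below (Collect low)" using low_nonneg by (intro bdd_belowI[of _ 0]) auto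
  have "folner_limit G f L" unfolding folner_limit_def
  proof (intro allI impI)
    fix h :: real assume h: "h > 0"
    have "Inf (Collect low) < L + h / 3" using h by (simp add: L_def)
    then obtain l where l: "low l" "l < L + h / 3"
      using cInf_lessD[of "Collect low"] \<open>low M\<close> by auto
    obtain E d where E: "finite E" "E \<subseteq> carrier G" "d > 0"
      and up: "\<And>F. almost_invariant G E d F \<Longrightarrow> f F \<le> (l + h / 3) * real (card F)"
    proof (rule eventually_le_of_low[OF f])
      show "\<exists>K. almost_invariant G E d K \<and> f K \<le> l * real (card K)"
        if "finite E" "E \<subseteq> carrier G" "d > 0" for E d
        using lowD[OF l(1)] that by simp
      show "h / 3 > 0" using h by simp
    qed auto
    have "\<not> low (L - h / 2)"
    proof
      assume "low (L - h / 2)"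
      then have "L \<le> L - h / 2" unfolding L_def using bdd by (intro cInf_lower) auto
      then show False using h by simp
    qed
    then obtain E' d' where E': "finite E'" "E' \<subseteq> carrier G" "d' > 0"
      and no: "\<not> (\<exists>K. almost_invariant G E' d' K \<and> f K \<le> (L - h / 2) * real (card K))"
      unfolding low_def by auto
    have "\<bar>f F / real (card F) - L\<bar> < h" if F: "almost_invariant G (E \<union> E') (min d d') F" for F
    proof -
      have c: "real (card F) > 0" using almost_invariant_card_pos[OF F] by simp
      have "almost_invariant G E d F" "almost_invariant G E' d' F"
        by (auto intro: almost_invariant_mono[OF F])
      then have "f F \<le> (l + h / 3) * real (card F)" "f F > (L - h / 2) * real (card F)"
        using up no by (auto simp: not_le[symmetric])
      then have "f F / real (card F) \<le> l + h / 3" "f F / real (card F) > L - h / 2"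
        using c by (simp_all add: pos_divide_le_eq pos_less_divide_eq)
      then show ?thesis using l(2) h by linarith
    qed
    moreover have "finite (E \<union> E')" "E \<union> E' \<subseteq> carrier G" "min d d' > 0" using E E' by auto
    ultimately show "\<exists>E d. finite E \<and> E \<subseteq> carrier G \<and> d > 0 \<and>
        (\<forall>F. almost_invariant G E d F \<longrightarrow> \<bar>f F / real (card F) - L\<bar> < h)" by blast
  qed
  then show thesis by (rule that)
qed

end

subsection \<open>Good sections\<close>

locale good_extension =
  S: cancellative_monoid S + C: cancellative_monoid C
  for S :: "('a, 'm) monoid_scheme" and C :: "('c, 'n) monoid_scheme" +
  fixes \<pi> :: "'a \<Rightarrow> 'c" and \<sigma> :: "'c \<Rightarrow> 'a"
  assumes epi: "\<pi> \<in> epi S C" and good: "good_section S C \<pi> \<sigma>"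
begin

abbreviation N :: "'a set" where "N \<equiv> kernel S C \<pi>"

abbreviation K :: "('a, 'm) monoid_scheme" where "K \<equiv> S\<lparr>carrier := N\<rparr>"

lemma hom_closed: "x \<in> carrier S \<Longrightarrow> \<pi> x \<in> carrier C"
  and hom_mult: "x \<in> carrier S \<Longrightarrow> y \<in> carrier S \<Longrightarrow> \<pi> (x \<otimes>\<^bsub>S\<^esub> y) = \<pi> x \<otimes>\<^bsub>C\<^esub> \<pi> y"
  using epi unfolding epi_def hom_def by auto

text \<open>Membership in \<open>epi\<close> yields multiplicativity and surjectivity; a preimage
  \<open>x\<close> of the unit gives
  \<open>\<pi>(1) = \<pi>(1) \<pi>(x) = \<pi>(1 x) = 1\<close>.\<close>

lemma hom_one: "\<pi> \<one>\<^bsub>S\<^esub> = \<one>\<^bsub>C\<^esub>"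
proof -
  have "\<one>\<^bsub>C\<^esub> \<in> \<pi> ` carrier S" using epi by (simp add: epi_def)
  then obtain x where x: "x \<in> carrier S" "\<pi> x = \<one>\<^bsub>C\<^esub>" by auto
  show ?thesis using hom_mult[of "\<one>\<^bsub>S\<^esub>" x] x hom_closed[of "\<one>\<^bsub>S\<^esub>"] by simp
qed

lemma kernelD: "n \<in> N \<Longrightarrow> n \<in> carrier S" "n \<in> N \<Longrightarrow> \<pi> n = \<one>\<^bsub>C\<^esub>"
  by (simp_all add: kernel_def)

lemma kernel_mult: "m \<in> N \<Longrightarrow> n \<in> N \<Longrightarrow> m \<otimes>\<^bsub>S\<^esub> n \<in> N"
  by (simp add: kernel_def hom_mult)

lemma section_closed: "c \<in> carrier C \<Longrightarrow> \<sigma> c \<in> carrier S"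
  and hom_section: "c \<in> carrier C \<Longrightarrow> \<pi> (\<sigma> c) = c"
  using good unfolding good_section_def by auto

text \<open>Each half of goodness has its own use: this one rewrites \<open>\<sigma>(x) s\<close> in
  \<open>product_almost_invariant\<close>, its mirror image decomposes \<open>S\<close> for the
  amenability of \<open>N\<close>.\<close>

lemma fibre_right:
  assumes "x \<in> carrier S"
  shows "\<exists>n\<in>N. x = n \<otimes>\<^bsub>S\<^esub> \<sigma> (\<pi> x)"
proof -
  have "{y \<in> carrier S. \<pi> y = \<pi> x} = N #>\<^bsub>S\<^esub> \<sigma> (\<pi> x)"
    using good[unfolded good_section_def, rule_format, OF hom_closed[OF assms]] by (elim conjE)
  then have "x \<in> N #>\<^bsub>S\<^esub> \<sigma> (\<pi> x)" using assms by blast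
  then show ?thesis by (simp add: r_coset_def)
qed

lemma fibre_left:
  assumes "x \<in> carrier S"
  shows "\<exists>n\<in>N. x = \<sigma> (\<pi> x) \<otimes>\<^bsub>S\<^esub> n"
proof -
  have "{y \<in> carrier S. \<pi> y = \<pi> x} = \<sigma> (\<pi> x) <#\<^bsub>S\<^esub> N"
    using good[unfolded good_section_def, rule_format, OF hom_closed[OF assms]] by (elim conjE)
  then have "x \<in> \<sigma> (\<pi> x) <#\<^bsub>S\<^esub> N" using assms by blast
  then show ?thesis by (simp add: l_coset_def)
qed

lemma kernel_cancellative_monoid: "cancellative_monoid K"
proof (rule cancellative_monoid.intro)
  show "monoid K"
    by (rule monoidI) (simp_all add: kernel_def hom_mult hom_one S.m_assoc)
  have "N \<subseteq> carrier S" by (auto simp: kernel_def)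
  then show "cancellative_monoid_axioms K"
    by (intro cancellative_monoid_axioms.intro)
      (simp add: cancellative_def S.inj_left S.inj_right subset_iff)
qed

lemma kernel_right_amenable:
  assumes "right_amenable S"
  shows "right_amenable K"
proof -
  from assms[unfolded right_amenable_def] obtain \<mu> :: "'a set \<Rightarrow> real" where
    pos: "\<forall>A. A \<subseteq> carrier S \<longrightarrow> 0 \<le> \<mu> A \<and> \<mu> A \<le> 1" and one: "\<mu> (carrier S) = 1" and
    add: "\<forall>A B. A \<subseteq> carrier S \<longrightarrow> B \<subseteq> carrier S \<longrightarrow> A \<inter> B = {} \<longrightarrow> \<mu> (A \<union> B) = \<mu> A + \<mu> B" and
    inv: "\<forall>s\<in>carrier S. \<forall>A. A \<subseteq> carrier S \<longrightarrow> \<mu> {x \<in> carrier S. x \<otimes>\<^bsub>S\<^esub> s \<in> A} = \<mu> A"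
    by (elim exE conjE)
  \<comment> \<open>\<open>A \<mapsto> \<sigma>(C) A\<close> carries subsets of \<open>N\<close> to subsets of \<open>S\<close> and commutes with the preimages under
    right multiplication by elements of \<open>N\<close>, so \<open>\<mu>\<close> can be pulled back along it.\<close>
  define X where "X A = (\<Union>c\<in>carrier C. \<sigma> c <#\<^bsub>S\<^esub> A)" for A
  have X: "x \<in> X A \<longleftrightarrow> (\<exists>c\<in>carrier C. \<exists>a\<in>A. x = \<sigma> c \<otimes>\<^bsub>S\<^esub> a)" for x A
    by (auto simp: X_def l_coset_def)
  \<comment> \<open>Applying \<pi> to \<open>\<sigma>(c) m\<close> recovers \<open>c\<close>, and
    left cancellation then recovers \<open>m\<close>, so the decomposition is unique.\<close>
  have Xmem: "\<sigma> c \<otimes>\<^bsub>S\<^esub> m \<in> X A \<longleftrightarrow> m \<in> A"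
    if c: "c \<in> carrier C" and m: "m \<in> N" and A: "A \<subseteq> N" for c m A
  proof
    assume "\<sigma> c \<otimes>\<^bsub>S\<^esub> m \<in> X A"
    then obtain c' a where ca: "c' \<in> carrier C" "a \<in> A" "\<sigma> c \<otimes>\<^bsub>S\<^esub> m = \<sigma> c' \<otimes>\<^bsub>S\<^esub> a"
      unfolding X by blast
    have a: "a \<in> N" using ca A by blast
    have "\<pi> (\<sigma> c \<otimes>\<^bsub>S\<^esub> m) = \<pi> (\<sigma> c' \<otimes>\<^bsub>S\<^esub> a)" using ca by simp
    then have "c = c'" using c m ca(1) a by (simp add: hom_mult kernelD section_closed hom_section)
    then have "m = a" using S.l_cancel'[of "\<sigma> c" m a] c m ca a by (simp add: kernelD section_closed)
    then show "m \<in> A" using ca by simp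
  next
    assume "m \<in> A"
    then show "\<sigma> c \<otimes>\<^bsub>S\<^esub> m \<in> X A" unfolding X using c by blast
  qed
  have decomp: "\<exists>c\<in>carrier C. \<exists>n\<in>N. x = \<sigma> c \<otimes>\<^bsub>S\<^esub> n" if "x \<in> carrier S" for x
    using fibre_left[OF that] hom_closed[OF that] by blast
  have Xc: "X A \<subseteq> carrier S" if "A \<subseteq> N" for A
  proof
    fix x assume "x \<in> X A"
    then obtain c a where ca: "c \<in> carrier C" "a \<in> A" "x = \<sigma> c \<otimes>\<^bsub>S\<^esub> a" unfolding X by blast
    then show "x \<in> carrier S" using kernelD(1)[of a] that by (auto simp: section_closed)
  qed
  \<comment> \<open>Every fibre is \<open>\<sigma>(c) N\<close>, so \<open>N\<close> receives the
    full mass 1.\<close>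
  have XN: "X N = carrier S"
  proof (intro equalityI Xc subsetI)
    fix x assume "x \<in> carrier S"
    then show "x \<in> X N" unfolding X using decomp by blast
  qed simp
  show ?thesis unfolding right_amenable_def
  proof (intro exI[of _ "\<lambda>A. \<mu> (X A)"] conjI allI impI ballI)
    fix A assume "A \<subseteq> carrier K"
    then have A: "A \<subseteq> N" by simp
    from pos[rule_format, OF Xc[OF A]] show "0 \<le> \<mu> (X A)" "\<mu> (X A) \<le> 1" by simp_all
  next
    show "\<mu> (X (carrier K)) = 1" using XN one by simp
  next
    fix A B assume "A \<subseteq> carrier K" "B \<subseteq> carrier K" and dis: "A \<inter> B = {}"
    then have A: "A \<subseteq> N" and B: "B \<subseteq> N" by simp_all
    have "X (A \<union> B) = X A \<union> X B" by (auto simp: X_def l_coset_def)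
    moreover have "X A \<inter> X B = {}"
    proof (rule ccontr)
      assume "X A \<inter> X B \<noteq> {}"
      then obtain x where x: "x \<in> X A" "x \<in> X B" by blast
      then obtain c a where "c \<in> carrier C" "a \<in> A" "x = \<sigma> c \<otimes>\<^bsub>S\<^esub> a" unfolding X[of x A] by blast
      then show False using x(2) Xmem[of c a B] A B dis by blast
    qed
    ultimately show "\<mu> (X (A \<union> B)) = \<mu> (X A) + \<mu> (X B)"
      using add[rule_format, OF Xc[OF A] Xc[OF B]] by simp
  next
    fix s A assume "s \<in> carrier K" "A \<subseteq> carrier K"
    then have s: "s \<in> N" and A: "A \<subseteq> N" by simp_all
    have sub: "{m \<in> N. m \<otimes>\<^bsub>S\<^esub> s \<in> A} \<subseteq> N" by blast
    have iff: "\<sigma> c \<otimes>\<^bsub>S\<^esub> m \<otimes>\<^bsub>S\<^esub> s \<in> X A \<longleftrightarrow> \<sigma> c \<otimes>\<^bsub>S\<^esub> m \<in> X {m \<in> N. m \<otimes>\<^bsub>S\<^esub> s \<in> A}"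
      if "c \<in> carrier C" "m \<in> N" for c m
      using that s Xmem[OF that(1) kernel_mult[OF that(2) s] A] Xmem[OF that sub]
      by (simp add: S.m_assoc section_closed kernelD)
    have "{x \<in> carrier S. x \<otimes>\<^bsub>S\<^esub> s \<in> X A} = X {m \<in> N. m \<otimes>\<^bsub>S\<^esub> s \<in> A}"
    proof (intro equalityI subsetI)
      fix x assume x: "x \<in> {x \<in> carrier S. x \<otimes>\<^bsub>S\<^esub> s \<in> X A}"
      then obtain c m where "c \<in> carrier C" "m \<in> N" "x = \<sigma> c \<otimes>\<^bsub>S\<^esub> m" using decomp by blast
      then show "x \<in> X {m \<in> N. m \<otimes>\<^bsub>S\<^esub> s \<in> A}" using x iff by simp
    next
      fix x assume x: "x \<in> X {m \<in> N. m \<otimes>\<^bsub>S\<^esub> s \<in> A}"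
      then have xc: "x \<in> carrier S" using Xc[OF sub] by blast
      then obtain c m where "c \<in> carrier C" "m \<in> N" "x = \<sigma> c \<otimes>\<^bsub>S\<^esub> m" using decomp by blast
      then show "x \<in> {x \<in> carrier S. x \<otimes>\<^bsub>S\<^esub> s \<in> X A}" using x xc iff by simp
    qed
    then have "\<mu> (X {m \<in> N. m \<otimes>\<^bsub>S\<^esub> s \<in> A}) = \<mu> (X A)"
      using inv[rule_format, OF kernelD(1)[OF s] Xc[OF A]] by simp
    then show "\<mu> (X {x \<in> carrier K. x \<otimes>\<^bsub>K\<^esub> s \<in> A}) = \<mu> (X A)" by simp
  qed
qed

section \<open>Products of Folner sets of \<open>N\<close> and \<open>C\<close>\<close>

lemma product_set:
  assumes A: "finite A" "A \<subseteq> N" "A \<noteq> {}" and X: "X \<in> fin_subsets C"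
  shows product_fin_subset: "A <#>\<^bsub>S\<^esub> \<sigma> ` X \<in> fin_subsets S"
    and product_eq_image: "A <#>\<^bsub>S\<^esub> \<sigma> ` X = (\<lambda>(a, x). a \<otimes>\<^bsub>S\<^esub> \<sigma> x) ` (A \<times> X)"
    and product_inj: "inj_on (\<lambda>(a, x). a \<otimes>\<^bsub>S\<^esub> \<sigma> x) (A \<times> X)"
proof -
  have X': "finite X" "X \<subseteq> carrier C" "X \<noteq> {}" using X by (simp_all add: fin_subsets_def)
  show eq: "A <#>\<^bsub>S\<^esub> \<sigma> ` X = (\<lambda>(a, x). a \<otimes>\<^bsub>S\<^esub> \<sigma> x) ` (A \<times> X)"
    by (auto simp: set_mult_def)
  have mem: "a \<in> carrier S" "\<pi> a = \<one>\<^bsub>C\<^esub>" "x \<in> carrier C" "\<sigma> x \<in> carrier S" "\<pi> (\<sigma> x) = x"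
    if "a \<in> A" "x \<in> X" for a x
  proof -
    have "a \<in> N" "x \<in> carrier C" using that A X' by auto
    then show "a \<in> carrier S" "\<pi> a = \<one>\<^bsub>C\<^esub>" "x \<in> carrier C" "\<sigma> x \<in> carrier S" "\<pi> (\<sigma> x) = x"
      by (simp_all add: kernelD section_closed hom_section)
  qed
  show "A <#>\<^bsub>S\<^esub> \<sigma> ` X \<in> fin_subsets S"
    unfolding eq fin_subsets_def using A X' mem by auto
  show "inj_on (\<lambda>(a, x). a \<otimes>\<^bsub>S\<^esub> \<sigma> x) (A \<times> X)"
  proof (rule inj_onI, clarsimp)
    fix a x b y assume abxy: "a \<in> A" "x \<in> X" "b \<in> A" "y \<in> X" and eq: "a \<otimes>\<^bsub>S\<^esub> \<sigma> x = b \<otimes>\<^bsub>S\<^esub> \<sigma> y"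
    \<comment> \<open>As \<open>A\<close> lies in the kernel, \<pi> recovers \<open>x\<close> from
      the product, and right cancellation of \<open>\<sigma>(x)\<close> recovers \<open>a\<close>.
      This is the source of \<open>|A \<sigma>(X)| = |A| |X|\<close>.\<close>
    then have "\<pi> (a \<otimes>\<^bsub>S\<^esub> \<sigma> x) = \<pi> (b \<otimes>\<^bsub>S\<^esub> \<sigma> y)" by simp
    then have "x = y" using mem[OF abxy(1,2)] mem[OF abxy(3,4)] by (simp add: hom_mult)
    then show "a = b \<and> x = y"
      using S.r_cancel'[of a "\<sigma> x" b] eq mem[OF abxy(1,2)] mem[OF abxy(3,4)] by simp
  qed
qed

text \<open>Makes \<open>ornstein_weiss\<close> applicable to the function that defines
  \<open>Theta\<close>. Multiplying by \<open>\<sigma>(X)\<close> on the right commutes with unions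
  and left translations; left subinvariance bounds the values on singletons by \<open>f\<close> at
  \<open>\<sigma>(X)\<close>.\<close>

lemma right_translate_subadd:
  assumes f: "f \<in> subadd_functions S" and X: "X \<in> fin_subsets C"
  shows "right_translate S f (\<sigma> ` X) \<in> subadd_functions K"
proof -
  let ?P = "\<lambda>A. A <#>\<^bsub>S\<^esub> \<sigma> ` X"
  have NK: "F \<in> fin_subsets K \<Longrightarrow> finite F \<and> F \<subseteq> N \<and> F \<noteq> {}" for F by (simp add: fin_subsets_def)
  have P: "?P F \<in> fin_subsets S" if "F \<in> fin_subsets K" for F
    using NK[OF that] X by (intro product_fin_subset) auto
  have X': "X \<subseteq> carrier C" using X by (simp add: fin_subsets_def)
  have sX: "\<sigma> ` X \<subseteq> carrier S" using X' section_closed by auto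
  have assoc: "?P (s <#\<^bsub>S\<^esub> F) = s <#\<^bsub>S\<^esub> ?P F" if "s \<in> carrier S" "F \<subseteq> carrier S" for s F
    unfolding l_coset_eq_set_mult using that sX by (intro S.set_mult_assoc_monoid) auto
  have sXfin: "\<sigma> ` X \<in> fin_subsets S" using X sX by (simp add: fin_subsets_def)
  show ?thesis unfolding subadd_functions_def right_translate_def
  proof (intro CollectI conjI ballI impI)
    fix F assume "F \<in> fin_subsets K"
    then show "0 \<le> f (?P F)" by (intro subadd_nonneg[OF f] P)
  next
    fix F F' assume "F \<in> fin_subsets K" "F' \<in> fin_subsets K" "F \<subseteq> F'"
    then show "f (?P F) \<le> f (?P F')"
      by (intro subadd_mono[OF f] P) (auto simp: set_mult_def)
  next
    fix F F' assume "F \<in> fin_subsets K" "F' \<in> fin_subsets K"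
    moreover have "?P (F \<union> F') = ?P F \<union> ?P F'" by (auto simp: set_mult_def)
    ultimately show "f (?P (F \<union> F')) \<le> f (?P F) + f (?P F')"
      using subadd_Un[OF f P P] by simp
  next
    fix s F assume s: "s \<in> carrier K" and F: "F \<in> fin_subsets K"
    have "s \<in> carrier S" "F \<subseteq> carrier S" using s NK[OF F] kernelD(1) by auto
    then have "f (?P (s <#\<^bsub>S\<^esub> F)) \<le> f (?P F)"
      unfolding assoc[OF \<open>s \<in> carrier S\<close> \<open>F \<subseteq> carrier S\<close>] by (intro subadd_l_coset[OF f] P F)
    then show "f (?P (s <#\<^bsub>K\<^esub> F)) \<le> f (?P F)" by (simp add: l_coset_def)
  next
    have "f (?P {s}) \<le> f (\<sigma> ` X)" if "s \<in> carrier K" for s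
    proof -
      have "s \<in> carrier S" using that kernelD(1) by simp
      then have "f (s <#\<^bsub>S\<^esub> \<sigma> ` X) \<le> f (\<sigma> ` X)" by (intro subadd_l_coset[OF f] sXfin)
      then show ?thesis by (simp add: l_coset_eq_set_mult)
    qed
    then show "\<exists>M\<ge>0. \<forall>s\<in>carrier K. f (?P {s}) \<le> M"
      using subadd_nonneg[OF f sXfin] by (intro exI[of _ "f (\<sigma> ` X)"]) auto
  qed
qed

text \<open>For \<open>x\<close> with \<open>x \<pi>(s) \<in> X\<close> one has \<open>\<sigma>(x) s = n \<sigma>(x \<pi>(s))\<close> with \<open>n \<in> N\<close>; the set \<open>D\<close>
  collects these finitely many \<open>n\<close>.\<close>

lemma product_almost_invariant:
  assumes E: "finite E" "E \<subseteq> carrier S" and X: "almost_invariant C (\<pi> ` E) (d / 2) X"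
  shows "\<exists>D. finite D \<and> D \<subseteq> N \<and>
    (\<forall>A. almost_invariant K D (d / 2) A \<longrightarrow> almost_invariant S E d (A <#>\<^bsub>S\<^esub> \<sigma> ` X))"
proof -
  have Xf: "X \<in> fin_subsets C" using X by (simp add: almost_invariant_def)
  then have X': "finite X" "X \<subseteq> carrier C" by (simp_all add: fin_subsets_def)
  have "\<forall>p\<in>X \<times> E. \<exists>n. n \<in> N \<and> \<sigma> (fst p) \<otimes>\<^bsub>S\<^esub> snd p = n \<otimes>\<^bsub>S\<^esub> \<sigma> (fst p \<otimes>\<^bsub>C\<^esub> \<pi> (snd p))"
  proof
    fix p assume "p \<in> X \<times> E"
    then have p: "fst p \<in> carrier C" "snd p \<in> carrier S" using X' E by auto
    then have "\<pi> (\<sigma> (fst p) \<otimes>\<^bsub>S\<^esub> snd p) = fst p \<otimes>\<^bsub>C\<^esub> \<pi> (snd p)"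
      by (simp add: hom_mult section_closed hom_section)
    then show "\<exists>n. n \<in> N \<and> \<sigma> (fst p) \<otimes>\<^bsub>S\<^esub> snd p = n \<otimes>\<^bsub>S\<^esub> \<sigma> (fst p \<otimes>\<^bsub>C\<^esub> \<pi> (snd p))"
      using fibre_right[of "\<sigma> (fst p) \<otimes>\<^bsub>S\<^esub> snd p"] p by (auto simp: section_closed)
  qed
  from bchoice[OF this] obtain n where n0: "\<forall>p\<in>X \<times> E. n p \<in> N \<and>
      \<sigma> (fst p) \<otimes>\<^bsub>S\<^esub> snd p = n p \<otimes>\<^bsub>S\<^esub> \<sigma> (fst p \<otimes>\<^bsub>C\<^esub> \<pi> (snd p))" by (rule exE)
  have n: "n (x, s) \<in> N" "\<sigma> x \<otimes>\<^bsub>S\<^esub> s = n (x, s) \<otimes>\<^bsub>S\<^esub> \<sigma> (x \<otimes>\<^bsub>C\<^esub> \<pi> s)"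
    if "x \<in> X" "s \<in> E" for x s
    using bspec[OF n0, of "(x, s)"] that by simp_all
  show ?thesis
  proof (intro exI[of _ "n ` (X \<times> E)"] conjI allI impI)
    show "finite (n ` (X \<times> E))" using X' E by simp
    show "n ` (X \<times> E) \<subseteq> N" using n(1) by auto
  next
    fix A assume A: "almost_invariant K (n ` (X \<times> E)) (d / 2) A"
    then have A': "finite A" "A \<subseteq> N" "A \<noteq> {}" by (auto simp: almost_invariant_def fin_subsets_def)
    define P where "P = A <#>\<^bsub>S\<^esub> \<sigma> ` X"
    define h where "h = (\<lambda>(a, x). a \<otimes>\<^bsub>S\<^esub> \<sigma> x)"
    have P: "P = h ` (A \<times> X)" and inj: "inj_on h (A \<times> X)" and Pf: "P \<in> fin_subsets S"
      using product_set[OF A' Xf] by (simp_all add: P_def h_def)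
    have cardP: "card P = card A * card X"
      unfolding P by (simp add: card_image[OF inj] card_cartesian_product)
    have "real (card {y \<in> P. y \<otimes>\<^bsub>S\<^esub> s \<notin> P}) \<le> d * real (card P)" if s: "s \<in> E" for s
    proof -
      have sc: "s \<in> carrier S" using s E by blast
      \<comment> \<open>Since \<open>a \<sigma>(x) s = a n \<sigma>(x \<pi>(s))\<close>, this point
        is outside \<open>P\<close> only if \<open>x \<pi>(s)\<close> leaves \<open>X\<close> or
        \<open>a n\<close> leaves \<open>A\<close>; \<open>B1\<close> and \<open>B2\<close> collect
        the two cases.\<close>
      define B1 where "B1 = {x \<in> X. x \<otimes>\<^bsub>C\<^esub> \<pi> s \<notin> X}"
      define B2 where "B2 x = {a \<in> A. a \<otimes>\<^bsub>S\<^esub> n (x, s) \<notin> A}" for x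
      have "{y \<in> P. y \<otimes>\<^bsub>S\<^esub> s \<notin> P} \<subseteq> h ` (A \<times> B1 \<union> (\<Union>x\<in>X. B2 x \<times> {x}))"
      proof
        fix y assume y: "y \<in> {y \<in> P. y \<otimes>\<^bsub>S\<^esub> s \<notin> P}"
        then obtain a x where ax: "a \<in> A" "x \<in> X" "y = a \<otimes>\<^bsub>S\<^esub> \<sigma> x" unfolding P h_def by auto
        have "a \<in> N" "x \<in> carrier C" using ax A' X' by auto
        then have c: "a \<in> carrier S" "\<sigma> x \<in> carrier S" "\<sigma> (x \<otimes>\<^bsub>C\<^esub> \<pi> s) \<in> carrier S"
            "n (x, s) \<in> carrier S"
          using sc n(1)[OF ax(2) s] by (auto simp: kernelD hom_closed section_closed)
        have "y \<otimes>\<^bsub>S\<^esub> s = a \<otimes>\<^bsub>S\<^esub> n (x, s) \<otimes>\<^bsub>S\<^esub> \<sigma> (x \<otimes>\<^bsub>C\<^esub> \<pi> s)"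
          using n(2)[OF ax(2) s] ax(3) c sc by (simp add: S.m_assoc)
        then have "y \<otimes>\<^bsub>S\<^esub> s = h (a \<otimes>\<^bsub>S\<^esub> n (x, s), x \<otimes>\<^bsub>C\<^esub> \<pi> s)" by (simp add: h_def)
        then have "\<not> (a \<otimes>\<^bsub>S\<^esub> n (x, s) \<in> A \<and> x \<otimes>\<^bsub>C\<^esub> \<pi> s \<in> X)" using y unfolding P by blast
        then have "(a, x) \<in> A \<times> B1 \<union> (\<Union>x\<in>X. B2 x \<times> {x})"
          using ax by (auto simp: B1_def B2_def)
        moreover have "y = h (a, x)" using ax by (simp add: h_def)
        ultimately show "y \<in> h ` (A \<times> B1 \<union> (\<Union>x\<in>X. B2 x \<times> {x}))" by blast
      qed
      moreover have fin: "finite (A \<times> B1 \<union> (\<Union>x\<in>X. B2 x \<times> {x}))"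
        using A' X' by (simp add: B1_def B2_def)
      ultimately have "card {y \<in> P. y \<otimes>\<^bsub>S\<^esub> s \<notin> P} \<le> card (A \<times> B1 \<union> (\<Union>x\<in>X. B2 x \<times> {x}))"
        by (rule surj_card_le[rotated])
      also have "\<dots> \<le> card (A \<times> B1) + card (\<Union>x\<in>X. B2 x \<times> {x})" by (rule card_Un_le)
      also have "\<dots> \<le> card A * card B1 + (\<Sum>x\<in>X. card (B2 x))"
        using card_UN_le[OF X'(1), of "\<lambda>x. B2 x \<times> {x}"] by (simp add: card_cartesian_product)
      finally have "real (card {y \<in> P. y \<otimes>\<^bsub>S\<^esub> s \<notin> P}) \<le> real (card A) * real (card B1) + (\<Sum>x\<in>X. real (card (B2 x)))"
        by (simp flip: of_nat_mult of_nat_add of_nat_sum)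
      \<comment> \<open>Either kind of escape contributes at most \<open>d / 2\<close> times
        \<open>|A| |X| = |P|\<close>.\<close>
      also have "\<dots> \<le> real (card A) * (d / 2 * real (card X)) + (\<Sum>x\<in>X. d / 2 * real (card A))"
      proof (intro add_mono mult_left_mono sum_mono)
        show "real (card B1) \<le> d / 2 * real (card X)"
          using X s unfolding almost_invariant_def B1_def by blast
        show "real (card (B2 x)) \<le> d / 2 * real (card A)" if "x \<in> X" for x
          using A s that unfolding almost_invariant_def B2_def by auto
      qed simp
      also have "\<dots> = d * real (card P)" by (simp add: cardP)
      finally show ?thesis .
    qed
    then show "almost_invariant S E d (A <#>\<^bsub>S\<^esub> \<sigma> ` X)"
      using Pf by (simp add: almost_invariant_def P_def)
  qed
qed

text \<open>The requirement on \<open>X\<close> comes from the limit along \<open>S\<close> alone,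
  while \<open>A\<close> is chosen after \<open>X\<close>. One \<open>A\<close> serves both the
  limit along \<open>N\<close> and the almost invariance of \<open>A \<sigma>(X)\<close> in
  \<open>S\<close>.\<close>

lemma folner_limit_Theta:
  assumes am: "right_amenable S" and f: "f \<in> subadd_functions S" and L: "folner_limit S f L"
  shows "folner_limit C (Theta S C \<pi> \<sigma> f) L"
  unfolding folner_limit_def
proof (intro allI impI)
  interpret K: cancellative_monoid K by (rule kernel_cancellative_monoid)
  note exK = K.almost_invariant_exists[OF kernel_right_amenable[OF am]]
  fix e :: real assume e: "e > 0"
  then have "e / 2 > 0" by simp
  from L[unfolded folner_limit_def, rule_format, OF this]
  obtain E d where E: "finite E" "E \<subseteq> carrier S" and d: "d > 0"
    and lim: "\<forall>F. almost_invariant S E d F \<longrightarrow> \<bar>f F / real (card F) - L\<bar> < e / 2"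
    by (elim exE conjE)
  have "\<bar>Theta S C \<pi> \<sigma> f X / real (card X) - L\<bar> < e"
    if X: "almost_invariant C (\<pi> ` E) (d / 2) X" for X
  proof -
    have Xf: "X \<in> fin_subsets C" using X by (simp add: almost_invariant_def)
    have X1: "real (card X) \<ge> 1" using almost_invariant_card_pos[OF X] by linarith
    let ?g = "right_translate S f (\<sigma> ` X)" and ?t = "Theta S C \<pi> \<sigma> f X"
    obtain t where t: "folner_limit K ?g t"
      by (rule K.ornstein_weiss[OF exK right_translate_subadd[OF f Xf]])
    have "?t = t" unfolding Theta_def by (rule K.folner_mean_eq_limit[OF exK t])
    with t have "folner_limit K ?g ?t" by simp
    from this[unfolded folner_limit_def, rule_format, OF \<open>e / 2 > 0\<close>]
    obtain E1 d1 where E1: "finite E1" "E1 \<subseteq> carrier K" and d1: "d1 > 0"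
      and lim1: "\<forall>A. almost_invariant K E1 d1 A \<longrightarrow> \<bar>?g A / real (card A) - ?t\<bar> < e / 2"
      by (elim exE conjE)
    from product_almost_invariant[OF E X] obtain D where D: "finite D" "D \<subseteq> N"
      "\<forall>A. almost_invariant K D (d / 2) A \<longrightarrow> almost_invariant S E d (A <#>\<^bsub>S\<^esub> \<sigma> ` X)"
      by (elim exE conjE)
    have "\<exists>A. almost_invariant K (E1 \<union> D) (min d1 (d / 2)) A"
      using E1 D(1,2) d d1 by (intro exK) auto
    then obtain A where A: "almost_invariant K (E1 \<union> D) (min d1 (d / 2)) A" by (elim exE)
    then have A': "finite A" "A \<subseteq> N" "A \<noteq> {}" by (auto simp: almost_invariant_def fin_subsets_def)
    let ?P = "A <#>\<^bsub>S\<^esub> \<sigma> ` X"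
    have cardP: "real (card ?P) = real (card A) * real (card X)"
      unfolding product_eq_image[OF A' Xf]
      by (simp add: card_image[OF product_inj[OF A' Xf]] card_cartesian_product)
    have "almost_invariant S E d ?P" by (intro D(3)[rule_format] almost_invariant_mono[OF A]) auto
    then have 1: "\<bar>f ?P / real (card ?P) - L\<bar> < e / 2" using lim by simp
    have "almost_invariant K E1 d1 A" by (intro almost_invariant_mono[OF A]) auto
    then have "\<bar>f ?P / real (card A) - ?t\<bar> < e / 2" using lim1 by (simp add: right_translate_def)
    \<comment> \<open>Since \<open>|X| \<ge> 1\<close>, dividing by it does not increase the error,
      and \<open>f ?P\<close> acquires the denominator \<open>|A| |X| = |?P|\<close>.\<close>
    then have "\<bar>f ?P / real (card A) - ?t\<bar> / real (card X) < e / 2"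
      using X1 by (smt (verit) divide_le_eq_1 frac_le div_by_1 abs_ge_zero)
    also have "\<bar>f ?P / real (card A) - ?t\<bar> / real (card X) = \<bar>f ?P / real (card ?P) - ?t / real (card X)\<bar>"
      using X1 by (simp add: cardP flip: divide_divide_eq_left diff_divide_distrib)
    finally show ?thesis using 1 by linarith
  qed
  moreover have "finite (\<pi> ` E)" "\<pi> ` E \<subseteq> carrier C" "d / 2 > 0"
    using E d hom_closed by auto
  ultimately show "\<exists>E d. finite E \<and> E \<subseteq> carrier C \<and> d > 0 \<and>
      (\<forall>F. almost_invariant C E d F \<longrightarrow> \<bar>Theta S C \<pi> \<sigma> f F / real (card F) - L\<bar> < e)" by blast
qed

end

text \<open>Both means are evaluated as the same \<open>L\<close>. Amenability of \<open>S\<close>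
  and \<open>C\<close> supplies the almost invariant sets that \<open>folner_mean_eq_limit\<close>
  asks for on either side.\<close>

theorem theorem3p10:
  fixes S :: "('a, 'm) monoid_scheme" and C :: "('c, 'n) monoid_scheme"
    and \<pi> :: "'a \<Rightarrow> 'c" and \<sigma> :: "'c \<Rightarrow> 'a" and f :: "'a set \<Rightarrow> real"
  assumes "monoid S" and "cancellative S" and "right_amenable S"
    and "monoid C" and "cancellative C" and "right_amenable C"
    and "\<pi> \<in> epi S C"
    and "good_section S C \<pi> \<sigma>"
    and "f \<in> subadd_functions S"
  shows "folner_mean S f = folner_mean C (Theta S C \<pi> \<sigma> f)"
proof -
  interpret good_extension S C \<pi> \<sigma>
    by (intro good_extension.intro good_extension_axioms.intro cancellative_monoid.intro
        cancellative_monoid_axioms.intro assms)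
  note exS = S.almost_invariant_exists[OF \<open>right_amenable S\<close>]
  note exC = C.almost_invariant_exists[OF \<open>right_amenable C\<close>]
  obtain L where L: "folner_limit S f L"
    by (rule S.ornstein_weiss[OF exS \<open>f \<in> subadd_functions S\<close>])
  have "folner_mean S f = L" by (rule S.folner_mean_eq_limit[OF exS L])
  also have "L = folner_mean C (Theta S C \<pi> \<sigma> f)"
    by (rule C.folner_mean_eq_limit[OF exC
        folner_limit_Theta[OF \<open>right_amenable S\<close> \<open>f \<in> subadd_functions S\<close> L], symmetric])
  finally show ?thesis .
qed

end
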